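(* Let $\mathbb K$ be a commutative unital ring, $(U,V)$ a linear set and $n\in\mathbb N$. The finite part $\mathsf{Gsyfi}^{\mathsf n}U$ of $\mathsf{Gsy}^{\mathsf n}U$ is isomorphic, as an $n$-fold groupoid, to the direct product of the $n$-fold pair groupoid of $U$ with the trivial $n$-fold groupoid $(\mathbb K^\times)^n$: $$\mathsf{Gsyfi}^{\mathsf n}U\cong\mathsf{PG}^{\mathsf n}(U)\times(\mathbb K^\times)^n.$$ On the vertex set at $\alpha\subset\{1,\dots,n\}$, over fixed $\mathbf t\in(\mathbb K^\times)^n$, the isomorphism is $$\mathsf{Gsy}^{\alpha;\mathsf n}_{\mathbf t}U\to\prod_{\gamma\subset\alpha}U,\qquad (v_\gamma)_{\gamma\subset\alpha}\mapsto(x_\gamma)_{\gamma\subset\alpha},\quad x_\gamma=\sum_{\delta\subset\gamma}\Bigl(\prod_{i\in\delta}t_i\Bigr)v_\delta .$$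
   Context: A linear set is a pair $(U,V)$, $V$ a $\mathbb K$-module, $U\subset V$. Groupoids have source $\pi_0$, target $\pi_1$, product $g'*g$ defined iff $\pi_1(g)=\pi_0(g')$. An $n$-fold groupoid is a family of sets $(C_\alpha)_{\alpha\subset\{1,\dots,n\}}$ with, for each edge $(\beta,\alpha=\beta\cup\{i\})$, $i\notin\beta$, a groupoid with morphisms $C_\alpha$ and objects $C_\beta$, such that each face gives a double groupoid; morphisms are families of maps that are groupoid morphisms on each edge. A trivial $n$-fold groupoid on a set $M$ has all vertex sets $M$ and all structure maps identities. For $\mathbf t\in\mathbb K^n$, $\mathsf{Gsy}^{\alpha;\mathsf n}_{\mathbf t}U=\{(v_\beta)_{\beta\subset\alpha}\in\prod_{\beta\subset\alpha}V:\forall\beta\subset\alpha,\ \sum_{\gamma\subset\beta}(\prod_{j\in\gamma}t_j)v_\gamma\in U\}$, and $\mathsf{Gsy}^{\mathsf n}U$ has vertex sets $\mathsf{Gsy}^{\alpha;\mathsf n}U=\{(\mathbf v,\mathbf t):\mathbf t\in\mathbb K^n,\ \mathbf v\in\mathsf{Gsy}^{\alpha;\mathsf n}_{\mathbf t}U\}$. For the edge $(\beta,\alpha=\beta\cup\{i\})$ and fixed $\mathbf t$: $\pi_0(\mathbf v)=(v_\gamma)_{\gamma\subset\beta}$, $\pi_1(\mathbf v)=(v_\gamma+t_iv_{\gamma\cup\{i\}})_{\gamma\subset\beta}$, units are extension by $0$, and $\mathbf v'*\mathbf v=\mathbf w$ with $w_\gamma=v_\gamma$, $w_{\gamma\cup\{i\}}=v_{\gamma\cup\{i\}}+v'_{\gamma\cup\{i\}}$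 ($\gamma\subset\beta$); all maps keep $\mathbf t$ fixed. $\mathsf{Gsyfi}^{\mathsf n}U$ is the part with $\mathbf t\in(\mathbb K^\times)^n$. $\mathsf{PG}^{\mathsf n}M$ for a set $M$: vertex sets $\prod_{\gamma\subset\alpha}M$; for the edge $(\beta,\alpha=\beta\cup\{i\})$: $\pi_0(x)=(x_\gamma)_{\gamma\subset\beta}$, $\pi_1(x)=(x_{\gamma\cup\{i\}})_{\gamma\subset\beta}$, unit $z$ with $z_\gamma=z_{\gamma\cup\{i\}}=x_\gamma$, and product $y*x$ defined iff $\pi_1(x)=\pi_0(y)$, with component $x_\gamma$ if $i\notin\gamma$ and $y_\gamma$ if $i\in\gamma$. *)

theory Defs
  imports "HOL-Algebra.Module"
begin

text \<open>The product \<open>gcomp G g' g\<close> is meaningful only if \<open>gtgt G g = gsrc G g'\<close>. All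
  structure maps are total HOL functions; only their values on the carriers matter.\<close>

record 'a groupoid_data =
  gobj :: "'a set"
  gmor :: "'a set"
  gsrc :: "'a \<Rightarrow> 'a"
  gtgt :: "'a \<Rightarrow> 'a"
  gunit :: "'a \<Rightarrow> 'a"
  gcomp :: "'a \<Rightarrow> 'a \<Rightarrow> 'a"

locale groupoid =
  fixes G :: "'a groupoid_data"
  assumes src_closed: "g \<in> gmor G \<Longrightarrow> gsrc G g \<in> gobj G"
    and tgt_closed: "g \<in> gmor G \<Longrightarrow> gtgt G g \<in> gobj G"
    and unit_closed: "x \<in> gobj G \<Longrightarrow> gunit G x \<in> gmor G"
    and comp_closed: "\<lbrakk>g' \<in> gmor G; g \<in> gmor G; gtgt G g = gsrc G g'\<rbrakk> \<Longrightarrow> gcomp G g' g \<in> gmor G"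
    and src_unit: "x \<in> gobj G \<Longrightarrow> gsrc G (gunit G x) = x"
    and tgt_unit: "x \<in> gobj G \<Longrightarrow> gtgt G (gunit G x) = x"
    and src_comp: "\<lbrakk>g' \<in> gmor G; g \<in> gmor G; gtgt G g = gsrc G g'\<rbrakk>
      \<Longrightarrow> gsrc G (gcomp G g' g) = gsrc G g"
    and tgt_comp: "\<lbrakk>g' \<in> gmor G; g \<in> gmor G; gtgt G g = gsrc G g'\<rbrakk>
      \<Longrightarrow> gtgt G (gcomp G g' g) = gtgt G g'"
    and comp_assoc: "\<lbrakk>g'' \<in> gmor G; g' \<in> gmor G; g \<in> gmor G;
        gtgt G g = gsrc G g'; gtgt G g' = gsrc G g''\<rbrakk>
      \<Longrightarrow> gcomp G (gcomp G g'' g') g = gcomp G g'' (gcomp G g' g)"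
    and comp_unit_right: "g \<in> gmor G \<Longrightarrow> gcomp G g (gunit G (gsrc G g)) = g"
    and comp_unit_left: "g \<in> gmor G \<Longrightarrow> gcomp G (gunit G (gtgt G g)) g = g"
    and inverse_exists: "g \<in> gmor G \<Longrightarrow> \<exists>h\<in>gmor G. gsrc G h = gtgt G g \<and> gtgt G h = gsrc G g
      \<and> gcomp G h g = gunit G (gsrc G g) \<and> gcomp G g h = gunit G (gtgt G g)"

definition groupoid_hom ::
    "'a groupoid_data \<Rightarrow> 'b groupoid_data \<Rightarrow> ('a \<Rightarrow> 'b) \<Rightarrow> ('a \<Rightarrow> 'b) \<Rightarrow> bool" where
  "groupoid_hom G H f0 f1 \<longleftrightarrow>
     f0 \<in> gobj G \<rightarrow> gobj H \<and> f1 \<in> gmor G \<rightarrow> gmor H \<and>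
     (\<forall>g\<in>gmor G. gsrc H (f1 g) = f0 (gsrc G g) \<and> gtgt H (f1 g) = f0 (gtgt G g)) \<and>
     (\<forall>x\<in>gobj G. f1 (gunit G x) = gunit H (f0 x)) \<and>
     (\<forall>g\<in>gmor G. \<forall>g'\<in>gmor G. gtgt G g = gsrc G g' \<longrightarrow>
        f1 (gcomp G g' g) = gcomp H (f1 g') (f1 g))"

definition prod_groupoid ::
    "'a groupoid_data \<Rightarrow> 'b groupoid_data \<Rightarrow> ('a \<times> 'b) groupoid_data" where
  "prod_groupoid G H = \<lparr>
     gobj = gobj G \<times> gobj H,
     gmor = gmor G \<times> gmor H,
     gsrc = map_prod (gsrc G) (gsrc H),
     gtgt = map_prod (gtgt G) (gtgt H),
     gunit = map_prod (gunit G) (gunit H),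
     gcomp = (\<lambda>(g', h') (g, h). (gcomp G g' g, gcomp H h' h))\<rparr>"

definition composable :: "'a groupoid_data \<Rightarrow> ('a \<times> 'a) set" where
  "composable G = {(g', g). g' \<in> gmor G \<and> g \<in> gmor G \<and> gtgt G g = gsrc G g'}"

text \<open>A square of groupoids
  \<open>H0\<close>: \<open>C10 \<rightrightarrows> C00\<close>, \<open>V0\<close>: \<open>C01 \<rightrightarrows> C00\<close>,
  \<open>H1\<close>: \<open>C11 \<rightrightarrows> C01\<close>, \<open>V1\<close>: \<open>C11 \<rightrightarrows> C10\<close>.
  The composable pairs of \<open>V1\<close> over those of \<open>V0\<close> form a groupoid with the componentwise
  structure of \<open>H1\<close>; that the product is a morphism on it is the interchange law.\<close>

definition composable_groupoid ::
    "'a groupoid_data \<Rightarrow> 'a groupoid_data \<Rightarrow> 'a groupoid_data \<Rightarrow> ('a \<times> 'a) groupoid_data" where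
  "composable_groupoid V0 H1 V1 =
     (prod_groupoid H1 H1) \<lparr>gobj := composable V0, gmor := composable V1\<rparr>"

definition structure_maps_hom ::
    "'a groupoid_data \<Rightarrow> 'a groupoid_data \<Rightarrow> 'a groupoid_data \<Rightarrow> 'a groupoid_data \<Rightarrow> bool" where
  "structure_maps_hom H0 V0 H1 V1 \<longleftrightarrow>
     groupoid_hom H1 H0 (gsrc V0) (gsrc V1) \<and>
     groupoid_hom H1 H0 (gtgt V0) (gtgt V1) \<and>
     groupoid_hom H0 H1 (gunit V0) (gunit V1) \<and>
     groupoid_hom (composable_groupoid V0 H1 V1) H1
       (\<lambda>(g', g). gcomp V0 g' g) (\<lambda>(g', g). gcomp V1 g' g)"

definition double_groupoid ::
    "'a groupoid_data \<Rightarrow> 'a groupoid_data \<Rightarrow> 'a groupoid_data \<Rightarrow> 'a groupoid_data \<Rightarrow> bool" where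
  "double_groupoid H0 V0 H1 V1 \<longleftrightarrow>
     groupoid H0 \<and> groupoid V0 \<and> groupoid H1 \<and> groupoid V1 \<and>
     gobj H0 = gobj V0 \<and> gmor H0 = gobj V1 \<and> gmor V0 = gobj H1 \<and> gmor H1 = gmor V1 \<and>
     structure_maps_hom H0 V0 H1 V1 \<and> structure_maps_hom V0 H0 V1 H1"

text \<open>\<open>edge C \<beta> i\<close> is the groupoid on the edge \<open>(\<beta>, insert i \<beta>)\<close>; it is relevant only for
  \<open>\<beta> \<subseteq> {1..n}\<close> and \<open>i \<in> {1..n} - \<beta>\<close>.\<close>

record 'a nfold_data =
  vert :: "nat set \<Rightarrow> 'a set"
  edge :: "nat set \<Rightarrow> nat \<Rightarrow> 'a groupoid_data"

locale nfold_groupoid =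
  fixes n :: nat and C :: "'a nfold_data"
  assumes edge_groupoid: "\<lbrakk>\<beta> \<subseteq> {1..n}; i \<in> {1..n} - \<beta>\<rbrakk> \<Longrightarrow> groupoid (edge C \<beta> i)"
    and edge_obj: "\<lbrakk>\<beta> \<subseteq> {1..n}; i \<in> {1..n} - \<beta>\<rbrakk> \<Longrightarrow> gobj (edge C \<beta> i) = vert C \<beta>"
    and edge_mor: "\<lbrakk>\<beta> \<subseteq> {1..n}; i \<in> {1..n} - \<beta>\<rbrakk> \<Longrightarrow> gmor (edge C \<beta> i) = vert C (insert i \<beta>)"
    and face: "\<lbrakk>\<beta> \<subseteq> {1..n}; i \<in> {1..n} - \<beta>; j \<in> {1..n} - \<beta>; i \<noteq> j\<rbrakk> \<Longrightarrow>
      double_groupoid (edge C \<beta> i) (edge C \<beta> j) (edge C (insert j \<beta>) i) (edge C (insert i \<beta>) j)"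

definition nfold_hom ::
    "nat \<Rightarrow> 'a nfold_data \<Rightarrow> 'b nfold_data \<Rightarrow> (nat set \<Rightarrow> 'a \<Rightarrow> 'b) \<Rightarrow> bool" where
  "nfold_hom n C D f \<longleftrightarrow>
     (\<forall>\<alpha>. \<alpha> \<subseteq> {1..n} \<longrightarrow> f \<alpha> \<in> vert C \<alpha> \<rightarrow> vert D \<alpha>) \<and>
     (\<forall>\<beta> i. \<beta> \<subseteq> {1..n} \<and> i \<in> {1..n} - \<beta> \<longrightarrow>
        groupoid_hom (edge C \<beta> i) (edge D \<beta> i) (f \<beta>) (f (insert i \<beta>)))"

definition nfold_iso ::
    "nat \<Rightarrow> 'a nfold_data \<Rightarrow> 'b nfold_data \<Rightarrow> (nat set \<Rightarrow> 'a \<Rightarrow> 'b) \<Rightarrow> bool" where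
  "nfold_iso n C D f \<longleftrightarrow> nfold_hom n C D f \<and>
     (\<exists>h. nfold_hom n D C h \<and>
       (\<forall>\<alpha>. \<alpha> \<subseteq> {1..n} \<longrightarrow>
          (\<forall>x\<in>vert C \<alpha>. h \<alpha> (f \<alpha> x) = x) \<and> (\<forall>y\<in>vert D \<alpha>. f \<alpha> (h \<alpha> y) = y)))"

definition nfold_prod :: "'a nfold_data \<Rightarrow> 'b nfold_data \<Rightarrow> ('a \<times> 'b) nfold_data" where
  "nfold_prod C D = \<lparr>
     vert = (\<lambda>\<alpha>. vert C \<alpha> \<times> vert D \<alpha>),
     edge = (\<lambda>\<beta> i. prod_groupoid (edge C \<beta> i) (edge D \<beta> i))\<rparr>"

text \<open>A full restriction of all vertex sets; it is again an n-fold groupoid only if \<open>S\<close>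
  is stable under the structure maps.\<close>

definition nfold_part :: "'a set \<Rightarrow> 'a nfold_data \<Rightarrow> 'a nfold_data" where
  "nfold_part S C = \<lparr>
     vert = (\<lambda>\<alpha>. vert C \<alpha> \<inter> S),
     edge = (\<lambda>\<beta> i. (edge C \<beta> i)
       \<lparr>gobj := gobj (edge C \<beta> i) \<inter> S, gmor := gmor (edge C \<beta> i) \<inter> S\<rparr>)\<rparr>"

definition nfold_trivial :: "'a set \<Rightarrow> 'a nfold_data" where
  "nfold_trivial M = \<lparr>
     vert = (\<lambda>\<alpha>. M),
     edge = (\<lambda>\<beta> i. \<lparr>gobj = M, gmor = M, gsrc = (\<lambda>x. x), gtgt = (\<lambda>x. x),
       gunit = (\<lambda>x. x), gcomp = (\<lambda>g' g. g)\<rparr>)\<rparr>"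

text \<open>A family indexed by the subsets of \<open>\<alpha>\<close> is a function on \<open>Pow \<alpha>\<close>, extended by
  \<open>undefined\<close>.\<close>

definition PG :: "'a set \<Rightarrow> (nat set \<Rightarrow> 'a) nfold_data" where
  "PG M = \<lparr>
     vert = (\<lambda>\<alpha>. Pow \<alpha> \<rightarrow>\<^sub>E M),
     edge = (\<lambda>\<beta> i. \<lparr>
       gobj = Pow \<beta> \<rightarrow>\<^sub>E M,
       gmor = Pow (insert i \<beta>) \<rightarrow>\<^sub>E M,
       gsrc = (\<lambda>x. \<lambda>\<gamma>\<in>Pow \<beta>. x \<gamma>),
       gtgt = (\<lambda>x. \<lambda>\<gamma>\<in>Pow \<beta>. x (insert i \<gamma>)),
       gunit = (\<lambda>x. \<lambda>\<gamma>\<in>Pow (insert i \<beta>). x (\<gamma> - {i})),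
       gcomp = (\<lambda>y x. \<lambda>\<gamma>\<in>Pow (insert i \<beta>). if i \<in> \<gamma> then y \<gamma> else x \<gamma>)\<rparr>)\<rparr>"

definition cube_sum ::
    "('k, 'm) ring_scheme \<Rightarrow> ('k, 'v, 'w) module_scheme \<Rightarrow>
     (nat \<Rightarrow> 'k) \<Rightarrow> (nat set \<Rightarrow> 'v) \<Rightarrow> nat set \<Rightarrow> 'v" where
  "cube_sum K V t v \<gamma> = (\<Oplus>\<^bsub>V\<^esub>\<delta>\<in>Pow \<gamma>. (\<Otimes>\<^bsub>K\<^esub>i\<in>\<delta>. t i) \<odot>\<^bsub>V\<^esub> v \<delta>)"

definition Gsy_fibre ::
    "('k, 'm) ring_scheme \<Rightarrow> ('k, 'v, 'w) module_scheme \<Rightarrow> 'v set \<Rightarrow>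
     (nat \<Rightarrow> 'k) \<Rightarrow> nat set \<Rightarrow> (nat set \<Rightarrow> 'v) set" where
  "Gsy_fibre K V U t \<alpha> =
     {v \<in> Pow \<alpha> \<rightarrow>\<^sub>E carrier V. \<forall>\<beta>. \<beta> \<subseteq> \<alpha> \<longrightarrow> cube_sum K V t v \<beta> \<in> U}"

definition Gsy_vert ::
    "('k, 'm) ring_scheme \<Rightarrow> ('k, 'v, 'w) module_scheme \<Rightarrow> nat \<Rightarrow> 'v set \<Rightarrow>
     nat set \<Rightarrow> ((nat set \<Rightarrow> 'v) \<times> (nat \<Rightarrow> 'k)) set" where
  "Gsy_vert K V n U \<alpha> =
     {(v, t). t \<in> {1..n} \<rightarrow>\<^sub>E carrier K \<and> v \<in> Gsy_fibre K V U t \<alpha>}"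

definition Gsy ::
    "('k, 'm) ring_scheme \<Rightarrow> ('k, 'v, 'w) module_scheme \<Rightarrow> nat \<Rightarrow> 'v set \<Rightarrow>
     ((nat set \<Rightarrow> 'v) \<times> (nat \<Rightarrow> 'k)) nfold_data" where
  "Gsy K V n U = \<lparr>
     vert = Gsy_vert K V n U,
     edge = (\<lambda>\<beta> i. \<lparr>
       gobj = Gsy_vert K V n U \<beta>,
       gmor = Gsy_vert K V n U (insert i \<beta>),
       gsrc = (\<lambda>(v, t). (\<lambda>\<gamma>\<in>Pow \<beta>. v \<gamma>, t)),
       gtgt = (\<lambda>(v, t). (\<lambda>\<gamma>\<in>Pow \<beta>. v \<gamma> \<oplus>\<^bsub>V\<^esub> t i \<odot>\<^bsub>V\<^esub> v (insert i \<gamma>), t)),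
       gunit = (\<lambda>(v, t). (\<lambda>\<gamma>\<in>Pow (insert i \<beta>). if i \<in> \<gamma> then \<zero>\<^bsub>V\<^esub> else v \<gamma>, t)),
       gcomp = (\<lambda>(v', t') (v, t).
         (\<lambda>\<gamma>\<in>Pow (insert i \<beta>). if i \<in> \<gamma> then v \<gamma> \<oplus>\<^bsub>V\<^esub> v' \<gamma> else v \<gamma>, t))\<rparr>)\<rparr>"

definition Gsyfi ::
    "('k, 'm) ring_scheme \<Rightarrow> ('k, 'v, 'w) module_scheme \<Rightarrow> nat \<Rightarrow> 'v set \<Rightarrow>
     ((nat set \<Rightarrow> 'v) \<times> (nat \<Rightarrow> 'k)) nfold_data" where
  "Gsyfi K V n U = nfold_part (UNIV \<times> ({1..n} \<rightarrow>\<^sub>E Units K)) (Gsy K V n U)"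

end

theory Submission
  imports Defs
begin

text \<open>For a family \<open>v\<close> indexed by the subsets of \<open>insert i \<beta>\<close>, splitting the cube sum over
  \<open>insert i \<gamma>\<close> according to membership of \<open>i\<close> gives
  \<open>cube_sum v (insert i \<gamma>) = cube_sum v \<gamma> + cube_sum (\<lambda>\<delta>. t i * v (insert i \<delta>)) \<gamma>\<close>.
  This identity has two consequences. First, the cube sums of source, target, unit and product
  are those of the pair groupoid of the cube sums. Second, by induction on the index set, \<open>v\<close> can
  be recovered from its cube sums as soon as all \<open>t i\<close> are units. Hence the cube sums form a
  family of bijections commuting with all structure maps, and the groupoid axioms and interchange
  laws of \<open>Gsyfi\<close> need no separate computation: they are transported from the product of the
  pair groupoid with the trivial one.\<close>

subsection \<open>Transport of structure along bijections\<close>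

text \<open>The structure maps are total functions, and compatibility with a map into another
  groupoid does not force their values into the carriers of \<open>G\<close>. This typing half of
  the axioms is therefore isolated; the equational half can be pulled back.\<close>

definition groupoid_closed :: "'a groupoid_data \<Rightarrow> bool" where
  "groupoid_closed G \<longleftrightarrow>
     gsrc G \<in> gmor G \<rightarrow> gobj G \<and> gtgt G \<in> gmor G \<rightarrow> gobj G \<and> gunit G \<in> gobj G \<rightarrow> gmor G \<and>
     (\<forall>g\<in>gmor G. \<forall>g'\<in>gmor G. gtgt G g = gsrc G g' \<longrightarrow> gcomp G g' g \<in> gmor G)"

lemma groupoid_imp_closed: "groupoid G \<Longrightarrow> groupoid_closed G"
  by (auto simp: groupoid_closed_def groupoid_def)

text \<open>Each equation compares two elements of a carrier of \<open>G\<close>, so it may be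
  checked after applying the injective \<open>f0\<close> or \<open>f1\<close>, which turns it into
  the same axiom of \<open>H\<close>. Surjectivity of \<open>f1\<close> serves to bring inverses
  back from \<open>H\<close>.\<close>

lemma groupoid_transport:
  assumes H: "groupoid H" and f: "groupoid_hom G H f0 f1" and G: "groupoid_closed G"
    and f0: "inj_on f0 (gobj G)" and f1: "bij_betw f1 (gmor G) (gmor H)"
  shows "groupoid G"
proof -
  interpret H: groupoid H by (rule H)
  have src: "gsrc G g \<in> gobj G" and tgt: "gtgt G g \<in> gobj G" if "g \<in> gmor G" for g
    using G that by (auto simp: groupoid_closed_def)
  have unit: "gunit G x \<in> gmor G" if "x \<in> gobj G" for x
    using G that by (auto simp: groupoid_closed_def)
  have comp: "gcomp G g' g \<in> gmor G" if "g \<in> gmor G" "g' \<in> gmor G" "gtgt G g = gsrc G g'" for g g'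
    using G that by (auto simp: groupoid_closed_def)
  have in0: "f0 x \<in> gobj H" if "x \<in> gobj G" for x
    using f that by (auto simp: groupoid_hom_def)
  have in1: "f1 x \<in> gmor H" if "x \<in> gmor G" for x
    using f that by (auto simp: groupoid_hom_def)
  have f_src: "f0 (gsrc G g) = gsrc H (f1 g)" and f_tgt: "f0 (gtgt G g) = gtgt H (f1 g)"
    if "g \<in> gmor G" for g
    using f that by (auto simp: groupoid_hom_def)
  have f_unit: "f1 (gunit G x) = gunit H (f0 x)" if "x \<in> gobj G" for x
    using f that by (auto simp: groupoid_hom_def)
  have f_comp: "f1 (gcomp G g' g) = gcomp H (f1 g') (f1 g)"
    if "g \<in> gmor G" "g' \<in> gmor G" "gtgt G g = gsrc G g'" for g g'
    using f that by (auto simp: groupoid_hom_def)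
  have f_eq: "gtgt H (f1 g) = gsrc H (f1 g')"
    if "g \<in> gmor G" "g' \<in> gmor G" "gtgt G g = gsrc G g'" for g g'
    using that f_src f_tgt by metis
  have eq0: "x = y" if "f0 x = f0 y" "x \<in> gobj G" "y \<in> gobj G" for x y
    using f0 that by (auto dest: inj_onD)
  have eq1: "x = y" if "f1 x = f1 y" "x \<in> gmor G" "y \<in> gmor G" for x y
    using f1 that by (auto simp: bij_betw_def dest: inj_onD)
  note closed = src tgt unit comp in0 in1
  note f_simps = f_src f_tgt f_unit f_comp f_eq
  have src_unit: "gsrc G (gunit G x) = x" if "x \<in> gobj G" for x
    by (rule eq0) (simp_all add: that closed f_simps H.src_unit)
  have tgt_unit: "gtgt G (gunit G x) = x" if "x \<in> gobj G" for x
    by (rule eq0) (simp_all add: that closed f_simps H.tgt_unit)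
  have src_comp: "gsrc G (gcomp G g' g) = gsrc G g"
    if "g' \<in> gmor G" "g \<in> gmor G" "gtgt G g = gsrc G g'" for g g'
    by (rule eq0) (simp_all add: that closed f_simps H.src_comp)
  have tgt_comp: "gtgt G (gcomp G g' g) = gtgt G g'"
    if "g' \<in> gmor G" "g \<in> gmor G" "gtgt G g = gsrc G g'" for g g'
    by (rule eq0) (simp_all add: that closed f_simps H.tgt_comp)
  show ?thesis
  proof (unfold_locales, goal_cases)
    \<comment> \<open>The numbers follow the order of the axioms of \<open>groupoid\<close>: 9 is
      associativity, 10 and 11 are the unit laws, 12 is inverses. The endpoint laws shown above
      ensure that the composites in 9 to 11 are defined.\<close>
    case (9 g'' g' g)
    then show ?case
      by (intro eq1) (simp_all add: closed f_simps src_comp tgt_comp H.comp_assoc)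
  next
    case (10 g)
    then show ?case
      by (intro eq1) (simp_all add: closed f_simps tgt_unit H.comp_unit_right)
  next
    case (11 g)
    then show ?case
      by (intro eq1) (simp_all add: closed f_simps src_unit H.comp_unit_left)
  next
    case (12 g)
    \<comment> \<open>The inverse of \<open>g\<close> will be the preimage of an inverse of
      \<open>f1 g\<close>.\<close>
    obtain k where k: "k \<in> gmor H" "gsrc H k = gtgt H (f1 g)" "gtgt H k = gsrc H (f1 g)"
      "gcomp H k (f1 g) = gunit H (gsrc H (f1 g))" "gcomp H (f1 g) k = gunit H (gtgt H (f1 g))"
      using H.inverse_exists in1 12 by blast
    then obtain h where h: "h \<in> gmor G" "f1 h = k"
      using f1 by (metis bij_betw_imp_surj_on imageE)
    have 1: "gsrc G h = gtgt G g" "gtgt G h = gsrc G g"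
      using 12 h k by (auto intro!: eq0 simp: closed f_simps)
    moreover have "gcomp G h g = gunit G (gsrc G g)" "gcomp G g h = gunit G (gtgt G g)"
      using 12 h k 1 by (auto intro!: eq1 simp: closed f_simps)
    ultimately show ?case using h by blast
  qed (simp_all add: closed src_unit tgt_unit src_comp tgt_comp)
qed

text \<open>All elements of the carriers of \<open>H\<close> are images, so the conditions are those
  on \<open>f0\<close> and \<open>f1\<close> read backwards. Only composability needs care: in
  \<open>H\<close> it is an equality of images under \<open>f0\<close>, and injectivity brings it
  back to \<open>G\<close>.\<close>

lemma groupoid_hom_inv_into:
  assumes f: "groupoid_hom G H f0 f1" and G: "groupoid_closed G" and H: "groupoid_closed H"
    and f0: "bij_betw f0 (gobj G) (gobj H)" and f1: "bij_betw f1 (gmor G) (gmor H)"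
  shows "groupoid_hom H G (inv_into (gobj G) f0) (inv_into (gmor G) f1)"
proof -
  let ?h0 = "inv_into (gobj G) f0" and ?h1 = "inv_into (gmor G) f1"
  have h0: "?h0 (f0 x) = x" if "x \<in> gobj G" for x
    using f0 that by (simp add: bij_betw_inv_into_left)
  have h1: "?h1 (f1 x) = x" if "x \<in> gmor G" for x
    using f1 that by (simp add: bij_betw_inv_into_left)
  have obj: "gobj H = f0 ` gobj G" and mor: "gmor H = f1 ` gmor G"
    using f0 f1 by (auto simp: bij_betw_def)
  have src: "gsrc H (f1 g) = f0 (gsrc G g)" and tgt: "gtgt H (f1 g) = f0 (gtgt G g)"
    and src_in: "gsrc G g \<in> gobj G" and tgt_in: "gtgt G g \<in> gobj G" if "g \<in> gmor G" for g
    using f G that by (auto simp: groupoid_hom_def groupoid_closed_def)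
  have unit: "gunit H (f0 x) = f1 (gunit G x)" "gunit G x \<in> gmor G" if "x \<in> gobj G" for x
    using f G that by (auto simp: groupoid_hom_def groupoid_closed_def)
  have comp: "gcomp H (f1 g') (f1 g) = f1 (gcomp G g' g) \<and> gcomp G g' g \<in> gmor G"
    if "g \<in> gmor G" "g' \<in> gmor G" "f0 (gtgt G g) = f0 (gsrc G g')" for g g'
  proof -
    have "gtgt G g = gsrc G g'"
      using f0 that src_in tgt_in by (auto simp: bij_betw_def dest: inj_onD)
    then show ?thesis
      using f G that by (auto simp: groupoid_hom_def groupoid_closed_def)
  qed
  show ?thesis
    unfolding groupoid_hom_def obj mor
    by (auto simp: h0 h1 src tgt src_in tgt_in unit comp)
qed

text \<open>The maps \<open>f00\<close>, \<open>f10\<close>, \<open>f01\<close>, \<open>f11\<close>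
  belong to the four corners of the square. Every identity between composites of structure maps
  takes values in one corner, and is checked after applying the injective map of that
  corner.\<close>

lemma structure_maps_hom_transport:
  assumes D: "structure_maps_hom H0' V0' H1' V1'"
    and homs: "groupoid_hom H0 H0' f00 f10" "groupoid_hom V0 V0' f00 f01"
      "groupoid_hom H1 H1' f01 f11" "groupoid_hom V1 V1' f10 f11"
    and closed: "groupoid_closed H0" "groupoid_closed V0" "groupoid_closed H1" "groupoid_closed V1"
    and inj: "inj_on f00 (gobj H0)" "inj_on f10 (gmor H0)" "inj_on f01 (gobj H1)" "inj_on f11 (gmor H1)"
    and eqs: "gobj V0 = gobj H0" "gobj V1 = gmor H0" "gmor V0 = gobj H1" "gmor V1 = gmor H1"
    and eqs': "gobj V0' = gobj H0'" "gobj V1' = gmor H0'" "gmor V0' = gobj H1'" "gmor V1' = gmor H1'"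
  shows "structure_maps_hom H0 V0 H1 V1"
proof -
  \<comment> \<open>Identifying the shared corners leaves four carriers, \<open>gobj H0\<close>,
    \<open>gmor H0\<close>, \<open>gobj H1\<close> and \<open>gmor H1\<close>.\<close>
  note closed = closed[unfolded groupoid_closed_def eqs]
  note homs = homs[unfolded groupoid_hom_def eqs eqs']
  note D = D[unfolded structure_maps_hom_def groupoid_hom_def eqs']
  have e00: "x = y" if "f00 x = f00 y" "x \<in> gobj H0" "y \<in> gobj H0" for x y
    using inj that by (auto dest: inj_onD)
  have e10: "x = y" if "f10 x = f10 y" "x \<in> gmor H0" "y \<in> gmor H0" for x y
    using inj that by (auto dest: inj_onD)
  have e01: "x = y" if "f01 x = f01 y" "x \<in> gobj H1" "y \<in> gobj H1" for x y
    using inj that by (auto dest: inj_onD)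
  have e11: "x = y" if "f11 x = f11 y" "x \<in> gmor H1" "y \<in> gmor H1" for x y
    using inj that by (auto dest: inj_onD)
  have c: "gsrc H0 x \<in> gobj H0" "gtgt H0 x \<in> gobj H0" "gunit V1 x \<in> gmor H1"
    if "x \<in> gmor H0" for x
    using closed that by auto
  have c': "gsrc V0 x \<in> gobj H0" "gtgt V0 x \<in> gobj H0" "gunit H1 x \<in> gmor H1"
    if "x \<in> gobj H1" for x
    using closed that by auto
  have c'': "gsrc V1 x \<in> gmor H0" "gtgt V1 x \<in> gmor H0" "gsrc H1 x \<in> gobj H1" "gtgt H1 x \<in> gobj H1"
    if "x \<in> gmor H1" for x
    using closed that by auto
  have c0: "gunit H0 x \<in> gmor H0" "gunit V0 x \<in> gobj H1" if "x \<in> gobj H0" for x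
    using closed that by auto
  have cH0: "gcomp H0 g' g \<in> gmor H0"
    if "g \<in> gmor H0" "g' \<in> gmor H0" "gtgt H0 g = gsrc H0 g'" for g g'
    using closed that by auto
  have cH1: "gcomp H1 g' g \<in> gmor H1"
    if "g \<in> gmor H1" "g' \<in> gmor H1" "gtgt H1 g = gsrc H1 g'" for g g'
    using closed that by auto
  have cV0: "gcomp V0 g' g \<in> gobj H1"
    if "g \<in> gobj H1" "g' \<in> gobj H1" "gtgt V0 g = gsrc V0 g'" for g g'
    using closed that by auto
  have cV1: "gcomp V1 g' g \<in> gmor H1"
    if "g \<in> gmor H1" "g' \<in> gmor H1" "gtgt V1 g = gsrc V1 g'" for g g'
    using closed that by auto
  note cl = c c' c'' c0 cH0 cH1 cV0 cV1
  have i: "f00 x \<in> gobj H0'" if "x \<in> gobj H0" for x using homs that by auto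
  have i10: "f10 x \<in> gmor H0'" "f00 (gsrc H0 x) = gsrc H0' (f10 x)" "f00 (gtgt H0 x) = gtgt H0' (f10 x)"
    "f11 (gunit V1 x) = gunit V1' (f10 x)"
    if "x \<in> gmor H0" for x using homs that by auto
  have i01: "f01 x \<in> gobj H1'" "f00 (gsrc V0 x) = gsrc V0' (f01 x)" "f00 (gtgt V0 x) = gtgt V0' (f01 x)"
    "f11 (gunit H1 x) = gunit H1' (f01 x)"
    if "x \<in> gobj H1" for x using homs that by auto
  have i11: "f11 x \<in> gmor H1'" "f01 (gsrc H1 x) = gsrc H1' (f11 x)" "f01 (gtgt H1 x) = gtgt H1' (f11 x)"
    "f10 (gsrc V1 x) = gsrc V1' (f11 x)" "f10 (gtgt V1 x) = gtgt V1' (f11 x)"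
    if "x \<in> gmor H1" for x using homs that by auto
  have i00: "f10 (gunit H0 x) = gunit H0' (f00 x)" "f01 (gunit V0 x) = gunit V0' (f00 x)"
    if "x \<in> gobj H0" for x using homs that by auto
  have iH0: "f10 (gcomp H0 g' g) = gcomp H0' (f10 g') (f10 g)" "gtgt H0' (f10 g) = gsrc H0' (f10 g')"
    if "g \<in> gmor H0" "g' \<in> gmor H0" "gtgt H0 g = gsrc H0 g'" for g g'
    using homs(1) that by auto
  have iH1: "f11 (gcomp H1 g' g) = gcomp H1' (f11 g') (f11 g)" "gtgt H1' (f11 g) = gsrc H1' (f11 g')"
    if "g \<in> gmor H1" "g' \<in> gmor H1" "gtgt H1 g = gsrc H1 g'" for g g'
    using homs(3) that by auto
  have iV0: "f01 (gcomp V0 g' g) = gcomp V0' (f01 g') (f01 g)" "gtgt V0' (f01 g) = gsrc V0' (f01 g')"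
    if "g \<in> gobj H1" "g' \<in> gobj H1" "gtgt V0 g = gsrc V0 g'" for g g'
    using homs(2) that by auto
  have iV1: "f11 (gcomp V1 g' g) = gcomp V1' (f11 g') (f11 g)" "gtgt V1' (f11 g) = gsrc V1' (f11 g')"
    if "g \<in> gmor H1" "g' \<in> gmor H1" "gtgt V1 g = gsrc V1 g'" for g g'
    using homs(4) that by auto
  note fs = i i10 i01 i11 i00 iH0 iH1 iV0 iV1
  have D1: "gsrc H0' (gsrc V1' g) = gsrc V0' (gsrc H1' g)" "gtgt H0' (gsrc V1' g) = gsrc V0' (gtgt H1' g)"
      "gsrc H0' (gtgt V1' g) = gtgt V0' (gsrc H1' g)" "gtgt H0' (gtgt V1' g) = gtgt V0' (gtgt H1' g)"
    if "g \<in> gmor H1'" for g using D that by auto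
  have D2: "gsrc V1' (gunit H1' x) = gunit H0' (gsrc V0' x)" "gtgt V1' (gunit H1' x) = gunit H0' (gtgt V0' x)"
    if "x \<in> gobj H1'" for x using D that by auto
  have D3: "gsrc V1' (gcomp H1' g' g) = gcomp H0' (gsrc V1' g') (gsrc V1' g)"
     "gtgt V1' (gcomp H1' g' g) = gcomp H0' (gtgt V1' g') (gtgt V1' g)"
    if "g \<in> gmor H1'" "g' \<in> gmor H1'" "gtgt H1' g = gsrc H1' g'" for g g' using D that by auto
  have D4: "gsrc H1' (gunit V1' g) = gunit V0' (gsrc H0' g)" "gtgt H1' (gunit V1' g) = gunit V0' (gtgt H0' g)"
    if "g \<in> gmor H0'" for g using D that by auto
  have D5: "gunit V1' (gunit H0' x) = gunit H1' (gunit V0' x)" if "x \<in> gobj H0'" for x using D that by auto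
  have D6: "gunit V1' (gcomp H0' g' g) = gcomp H1' (gunit V1' g') (gunit V1' g)"
    if "g \<in> gmor H0'" "g' \<in> gmor H0'" "gtgt H0' g = gsrc H0' g'" for g g' using D that by auto
  \<comment> \<open>This condition lives on a groupoid of composable pairs; it is unfolded into
    statements about single arrows, the last of which, \<open>D9\<close>, is the interchange
    law.\<close>
  have D': "groupoid_hom (composable_groupoid V0' H1' V1') H1'
       (\<lambda>(g', g). gcomp V0' g' g) (\<lambda>(g', g). gcomp V1' g' g)"
    using assms(1) by (simp add: structure_maps_hom_def)
  note D' = D'[unfolded groupoid_hom_def composable_groupoid_def prod_groupoid_def composable_def eqs', simplified]
  have D7: "gsrc H1' (gcomp V1' g' g) = gcomp V0' (gsrc H1' g') (gsrc H1' g)"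
      "gtgt H1' (gcomp V1' g' g) = gcomp V0' (gtgt H1' g') (gtgt H1' g)"
    if "g \<in> gmor H1'" "g' \<in> gmor H1'" "gtgt V1' g = gsrc V1' g'" for g g' using D' that by auto
  have D8: "gunit H1' (gcomp V0' g' g) = gcomp V1' (gunit H1' g') (gunit H1' g)"
    if "g \<in> gobj H1'" "g' \<in> gobj H1'" "gtgt V0' g = gsrc V0' g'" for g g' using D' that by auto
  have D9: "gcomp V1' (gcomp H1' b' a') (gcomp H1' b a) = gcomp H1' (gcomp V1' b' b) (gcomp V1' a' a)"
    if "a \<in> gmor H1'" "a' \<in> gmor H1'" "b \<in> gmor H1'" "b' \<in> gmor H1'"
     "gtgt V1' a = gsrc V1' a'" "gtgt V1' b = gsrc V1' b'"
     "gtgt H1' a = gsrc H1' b" "gtgt H1' a' = gsrc H1' b'" for a a' b b' using D' that by auto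
  note Ds = D1 D2 D3 D4 D5 D6 D7 D8 D9
  have s: "gsrc H0 (gsrc V1 g) = gsrc V0 (gsrc H1 g)" "gtgt H0 (gsrc V1 g) = gsrc V0 (gtgt H1 g)"
      "gsrc H0 (gtgt V1 g) = gtgt V0 (gsrc H1 g)" "gtgt H0 (gtgt V1 g) = gtgt V0 (gtgt H1 g)"
    if "g \<in> gmor H1" for g
    by (rule e00; simp add: that cl fs Ds)+
  have s2: "gsrc V1 (gunit H1 x) = gunit H0 (gsrc V0 x)" "gtgt V1 (gunit H1 x) = gunit H0 (gtgt V0 x)"
    if "x \<in> gobj H1" for x
    by (rule e10; simp add: that cl fs Ds)+
  \<comment> \<open>A morphism can be pushed through a product only when the factors are composable.
    By \<open>s\<close>, composability in one direction passes to the sources and targets in the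
    other direction.\<close>
  have q: "gtgt V0 (gsrc H1 g) = gsrc V0 (gsrc H1 g')" "gtgt V0 (gtgt H1 g) = gsrc V0 (gtgt H1 g')"
    if "g \<in> gmor H1" "g' \<in> gmor H1" "gtgt V1 g = gsrc V1 g'" for g g'
    using that s by metis+
  have q2: "gtgt H0 (gsrc V1 g) = gsrc H0 (gsrc V1 g')" "gtgt H0 (gtgt V1 g) = gsrc H0 (gtgt V1 g')"
    if "g \<in> gmor H1" "g' \<in> gmor H1" "gtgt H1 g = gsrc H1 g'" for g g'
    using that s by metis+
  have s3: "gsrc V1 (gcomp H1 g' g) = gcomp H0 (gsrc V1 g') (gsrc V1 g)"
     "gtgt V1 (gcomp H1 g' g) = gcomp H0 (gtgt V1 g') (gtgt V1 g)"
    if "g \<in> gmor H1" "g' \<in> gmor H1" "gtgt H1 g = gsrc H1 g'" for g g'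
    by (rule e10; simp add: that cl fs Ds q2)+
  have s4: "gsrc H1 (gunit V1 g) = gunit V0 (gsrc H0 g)" "gtgt H1 (gunit V1 g) = gunit V0 (gtgt H0 g)"
    if "g \<in> gmor H0" for g
    by (rule e01; simp add: that cl fs Ds)+
  have s5: "gunit V1 (gunit H0 x) = gunit H1 (gunit V0 x)" if "x \<in> gobj H0" for x
    by (rule e11; simp add: that cl fs Ds)
  have s6: "gunit V1 (gcomp H0 g' g) = gcomp H1 (gunit V1 g') (gunit V1 g)"
    if "g \<in> gmor H0" "g' \<in> gmor H0" "gtgt H0 g = gsrc H0 g'" for g g'
    by (rule e11; simp add: that cl fs Ds s4)
  have s7: "gsrc H1 (gcomp V1 g' g) = gcomp V0 (gsrc H1 g') (gsrc H1 g)"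
      "gtgt H1 (gcomp V1 g' g) = gcomp V0 (gtgt H1 g') (gtgt H1 g)"
    if "g \<in> gmor H1" "g' \<in> gmor H1" "gtgt V1 g = gsrc V1 g'" for g g'
    by (rule e01; simp add: that cl fs Ds q)+
  have s8: "gunit H1 (gcomp V0 g' g) = gcomp V1 (gunit H1 g') (gunit H1 g)"
    if "g \<in> gobj H1" "g' \<in> gobj H1" "gtgt V0 g = gsrc V0 g'" for g g'
    by (rule e11; simp add: that cl fs Ds s2)
  \<comment> \<open>Both outer products are defined: \<open>s3\<close> and \<open>s7\<close> express
    the endpoints of the inner products as products of endpoints, and these match.\<close>
  have s9: "gcomp V1 (gcomp H1 b' a') (gcomp H1 b a) = gcomp H1 (gcomp V1 b' b) (gcomp V1 a' a)"
    if "a \<in> gmor H1" "a' \<in> gmor H1" "b \<in> gmor H1" "b' \<in> gmor H1"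
     "gtgt V1 a = gsrc V1 a'" "gtgt V1 b = gsrc V1 b'"
     "gtgt H1 a = gsrc H1 b" "gtgt H1 a' = gsrc H1 b'" for a a' b b'
    by (rule e11; simp add: that cl fs Ds s3 s7)
  show ?thesis
    unfolding structure_maps_hom_def groupoid_hom_def composable_groupoid_def prod_groupoid_def
      composable_def eqs
    by (auto simp: cl s s2 s3 s4 s5 s6 s7 s8 s9 q)
qed

text \<open>This reduces the axioms of \<open>C\<close> to those of a known model \<open>D\<close>:
  what remains to be checked in \<open>C\<close> itself is the typing of its structure maps.\<close>

lemma nfold_groupoid_transport:
  assumes D: "nfold_groupoid n D" and f: "nfold_hom n C D f"
    and bij: "\<And>\<alpha>. \<alpha> \<subseteq> {1..n} \<Longrightarrow> bij_betw (f \<alpha>) (vert C \<alpha>) (vert D \<alpha>)"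
    and obj: "\<And>\<beta> i. \<lbrakk>\<beta> \<subseteq> {1..n}; i \<in> {1..n} - \<beta>\<rbrakk> \<Longrightarrow> gobj (edge C \<beta> i) = vert C \<beta>"
    and mor: "\<And>\<beta> i. \<lbrakk>\<beta> \<subseteq> {1..n}; i \<in> {1..n} - \<beta>\<rbrakk> \<Longrightarrow> gmor (edge C \<beta> i) = vert C (insert i \<beta>)"
    and closed: "\<And>\<beta> i. \<lbrakk>\<beta> \<subseteq> {1..n}; i \<in> {1..n} - \<beta>\<rbrakk> \<Longrightarrow> groupoid_closed (edge C \<beta> i)"
  shows "nfold_groupoid n C"
proof -
  interpret D: nfold_groupoid n D by (rule D)
  have hom: "groupoid_hom (edge C \<beta> i) (edge D \<beta> i) (f \<beta>) (f (insert i \<beta>))"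
    if "\<beta> \<subseteq> {1..n}" "i \<in> {1..n} - \<beta>" for \<beta> i
    using f that by (simp add: nfold_hom_def)
  have inj: "inj_on (f \<alpha>) (vert C \<alpha>)" if "\<alpha> \<subseteq> {1..n}" for \<alpha>
    using bij that by (simp add: bij_betw_def)
  have grp: "groupoid (edge C \<beta> i)" if "\<beta> \<subseteq> {1..n}" "i \<in> {1..n} - \<beta>" for \<beta> i
    using that
    by (intro groupoid_transport[OF D.edge_groupoid hom closed])
      (auto simp: obj mor D.edge_mor intro!: bij inj)
  have square: "structure_maps_hom (edge C \<beta> i) (edge C \<beta> j) (edge C (insert j \<beta>) i) (edge C (insert i \<beta>) j)"
    if ij: "\<beta> \<subseteq> {1..n}" "i \<in> {1..n} - \<beta>" "j \<in> {1..n} - \<beta>" "i \<noteq> j" for \<beta> i j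
  proof (rule structure_maps_hom_transport)
    show "structure_maps_hom (edge D \<beta> i) (edge D \<beta> j) (edge D (insert j \<beta>) i) (edge D (insert i \<beta>) j)"
      using D.face[OF ij] by (simp add: double_groupoid_def)
    show "groupoid_hom (edge C \<beta> i) (edge D \<beta> i) (f \<beta>) (f (insert i \<beta>))"
      "groupoid_hom (edge C \<beta> j) (edge D \<beta> j) (f \<beta>) (f (insert j \<beta>))"
      by (rule hom; use ij in simp)+
    show "groupoid_hom (edge C (insert j \<beta>) i) (edge D (insert j \<beta>) i)
        (f (insert j \<beta>)) (f (insert i (insert j \<beta>)))"
      by (rule hom) (use ij in auto)
    show "groupoid_hom (edge C (insert i \<beta>) j) (edge D (insert i \<beta>) j)
        (f (insert i \<beta>)) (f (insert i (insert j \<beta>)))"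
      \<comment> \<open>The top corner is reached along two paths, giving
        \<open>insert i (insert j _)\<close> and \<open>insert j (insert i _)\<close>.\<close>
      by (subst insert_commute, rule hom) (use ij in auto)
  qed (use ij in \<open>auto intro!: hom closed inj simp: obj mor D.edge_obj D.edge_mor insert_commute\<close>)
  \<comment> \<open>\<open>square\<close> is used twice, the second time with \<open>i\<close> and
    \<open>j\<close> exchanged.\<close>
  have "double_groupoid (edge C \<beta> i) (edge C \<beta> j) (edge C (insert j \<beta>) i) (edge C (insert i \<beta>) j)"
    if ij: "\<beta> \<subseteq> {1..n}" "i \<in> {1..n} - \<beta>" "j \<in> {1..n} - \<beta>" "i \<noteq> j" for \<beta> i j
    using ij by (auto simp: double_groupoid_def obj mor insert_commute intro!: grp square)
  with grp obj mor show ?thesis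
    by (rule nfold_groupoid.intro)
qed

text \<open>The vertexwise inverses form a morphism because the condition on each edge is inherited
  through \<open>groupoid_hom_inv_into\<close>.\<close>

lemma nfold_iso_if_bij:
  assumes C: "nfold_groupoid n C" and D: "nfold_groupoid n D" and f: "nfold_hom n C D f"
    and bij: "\<And>\<alpha>. \<alpha> \<subseteq> {1..n} \<Longrightarrow> bij_betw (f \<alpha>) (vert C \<alpha>) (vert D \<alpha>)"
  shows "nfold_iso n C D f"
proof -
  interpret C: nfold_groupoid n C by (rule C)
  interpret D: nfold_groupoid n D by (rule D)
  let ?h = "\<lambda>\<alpha>. inv_into (vert C \<alpha>) (f \<alpha>)"
  have inv: "?h \<alpha> \<in> vert D \<alpha> \<rightarrow> vert C \<alpha>" "\<forall>x\<in>vert C \<alpha>. ?h \<alpha> (f \<alpha> x) = x"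
      "\<forall>y\<in>vert D \<alpha>. f \<alpha> (?h \<alpha> y) = y" if "\<alpha> \<subseteq> {1..n}" for \<alpha>
    using bij[OF that] bij_betw_inv_into[OF bij[OF that]]
    by (auto simp: bij_betw_inv_into_left bij_betw_inv_into_right dest: bij_betw_apply)
  have "groupoid_hom (edge D \<beta> i) (edge C \<beta> i) (?h \<beta>) (?h (insert i \<beta>))"
    if i: "\<beta> \<subseteq> {1..n}" "i \<in> {1..n} - \<beta>" for \<beta> i
  proof -
    have "groupoid_hom (edge C \<beta> i) (edge D \<beta> i) (f \<beta>) (f (insert i \<beta>))"
      using f i by (simp add: nfold_hom_def)
    from groupoid_hom_inv_into[OF this] show ?thesis
      using i bij C.edge_groupoid[OF i] D.edge_groupoid[OF i]
      by (simp add: C.edge_obj C.edge_mor D.edge_obj D.edge_mor groupoid_imp_closed)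
  qed
  then have "nfold_hom n D C ?h"
    using inv(1) by (simp add: nfold_hom_def)
  with f inv(2,3) show ?thesis
    unfolding nfold_iso_def by blast
qed

section \<open>Products and trivial n-fold groupoids\<close>

lemma groupoid_prod:
  assumes G: "groupoid G" and H: "groupoid H"
  shows "groupoid (prod_groupoid G H)"
proof -
  interpret G: groupoid G by (rule G)
  interpret H: groupoid H by (rule H)
  show ?thesis
  proof (unfold_locales, goal_cases)
    case (12 p)
    then obtain g h where p: "p = (g, h)" "g \<in> gmor G" "h \<in> gmor H"
      by (auto simp: prod_groupoid_def)
    with G.inverse_exists[of g] H.inverse_exists[of h] show ?case
      by (fastforce simp: prod_groupoid_def)
  qed (auto simp: prod_groupoid_def G.src_closed H.src_closed G.tgt_closed H.tgt_closed
      G.unit_closed H.unit_closed G.comp_closed H.comp_closed G.src_unit H.src_unit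
      G.tgt_unit H.tgt_unit G.src_comp H.src_comp G.tgt_comp H.tgt_comp G.comp_assoc H.comp_assoc
      G.comp_unit_left H.comp_unit_left G.comp_unit_right H.comp_unit_right)
qed

lemma structure_maps_hom_prod:
  assumes "structure_maps_hom H0 V0 H1 V1" and "structure_maps_hom H0' V0' H1' V1'"
  shows "structure_maps_hom (prod_groupoid H0 H0') (prod_groupoid V0 V0')
    (prod_groupoid H1 H1') (prod_groupoid V1 V1')"
proof -
  note * = structure_maps_hom_def groupoid_hom_def composable_groupoid_def prod_groupoid_def composable_def
  show ?thesis
    using assms unfolding * by (simp add: Pi_iff split_beta)
qed

lemma nfold_groupoid_prod:
  assumes C: "nfold_groupoid n C" and D: "nfold_groupoid n D"
  shows "nfold_groupoid n (nfold_prod C D)"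
proof -
  interpret C: nfold_groupoid n C by (rule C)
  interpret D: nfold_groupoid n D by (rule D)
  show ?thesis
  proof (rule nfold_groupoid.intro, goal_cases)
    case (4 \<beta> i j)
    with C.face[OF 4] D.face[OF 4] show ?case
      by (auto simp: nfold_prod_def double_groupoid_def groupoid_prod structure_maps_hom_prod)
       (auto simp: prod_groupoid_def)
  qed (auto simp: nfold_prod_def groupoid_prod C.edge_groupoid D.edge_groupoid,
      auto simp: prod_groupoid_def C.edge_obj D.edge_obj C.edge_mor D.edge_mor)
qed

lemma nfold_groupoid_trivial: "nfold_groupoid n (nfold_trivial M)"
  by (rule nfold_groupoid.intro)
    (auto simp: nfold_trivial_def double_groupoid_def structure_maps_hom_def groupoid_hom_def
      composable_groupoid_def composable_def prod_groupoid_def intro!: groupoid.intro)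

subsection \<open>The pair groupoid\<close>

lemma groupoid_PG:
  assumes "i \<notin> \<beta>"
  shows "groupoid (edge (PG M) \<beta> i)"
proof -
  have d: "\<gamma> - {i} = \<gamma>" if "\<gamma> \<subseteq> \<beta>" for \<gamma>
    using assms that by auto
  show ?thesis
  proof (unfold_locales, goal_cases)
    case (12 x)
    \<comment> \<open>An arrow of the pair groupoid is inverted by exchanging its two ends, here the
      entries at \<gamma> and at \<gamma> with \<open>i\<close> added.\<close>
    let ?y = "\<lambda>\<gamma>\<in>Pow (insert i \<beta>). if i \<in> \<gamma> then x (\<gamma> - {i}) else x (insert i \<gamma>)"
    from 12 have x: "x \<in> Pow (insert i \<beta>) \<rightarrow>\<^sub>E M" by (simp add: PG_def)
    have "?y \<in> gmor (edge (PG M) \<beta> i)"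
      using x by (auto simp: PG_def intro!: PiE_mem[OF x])
    moreover have "gsrc (edge (PG M) \<beta> i) ?y = gtgt (edge (PG M) \<beta> i) x"
      using assms x by (auto simp: PG_def fun_eq_iff restrict_def)
    moreover have "gtgt (edge (PG M) \<beta> i) ?y = gsrc (edge (PG M) \<beta> i) x"
      using assms x by (auto simp: PG_def fun_eq_iff restrict_def d)
    moreover have "gcomp (edge (PG M) \<beta> i) ?y x = gunit (edge (PG M) \<beta> i) (gsrc (edge (PG M) \<beta> i) x)"
      using assms x by (auto simp: PG_def fun_eq_iff restrict_def insert_absorb)
    moreover have "gcomp (edge (PG M) \<beta> i) x ?y = gunit (edge (PG M) \<beta> i) (gtgt (edge (PG M) \<beta> i) x)"
      using assms x by (auto simp: PG_def fun_eq_iff restrict_def insert_absorb)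
    ultimately show ?case by blast
  next
    case (10 x)
    then have "x \<in> Pow (insert i \<beta>) \<rightarrow>\<^sub>E M" by (simp add: PG_def)
    with assms show ?case
      by (auto simp: PG_def fun_eq_iff restrict_def PiE_def extensional_def)
  next
    case (11 x)
    then have "x \<in> Pow (insert i \<beta>) \<rightarrow>\<^sub>E M" by (simp add: PG_def)
    with assms show ?case
      by (auto simp: PG_def fun_eq_iff restrict_def PiE_def extensional_def insert_absorb)
  qed (use assms in \<open>auto simp: PG_def fun_eq_iff restrict_def PiE_def extensional_def Pi_iff d\<close>)
qed

text \<open>A structure map in direction \<open>i\<close> only inserts \<open>i\<close> into an
  index, removes it, or selects according to its membership. Such operations for distinct
  \<open>i\<close> and \<open>j\<close> do not interfere, so the identities hold entry by
  entry.\<close>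

lemma structure_maps_hom_PG:
  assumes "i \<notin> \<beta>" "j \<notin> \<beta>" "i \<noteq> j"
  shows "structure_maps_hom (edge (PG M) \<beta> i) (edge (PG M) \<beta> j)
    (edge (PG M) (insert j \<beta>) i) (edge (PG M) (insert i \<beta>) j)"
proof -
  have swap: "\<gamma> - {i} - {j} = \<gamma> - {j} - {i}" for \<gamma> :: "nat set"
    by auto
  show ?thesis
    unfolding structure_maps_hom_def groupoid_hom_def composable_groupoid_def prod_groupoid_def
      composable_def PG_def
    using assms
    by (auto simp: PiE_iff restrict_def fun_eq_iff extensional_def insert_commute insert_Diff_if
        swap split: if_splits)
qed

lemma nfold_groupoid_PG: "nfold_groupoid n (PG M)"
proof (rule nfold_groupoid.intro, goal_cases)
  case (4 \<beta> i j)
  then have "structure_maps_hom (edge (PG M) \<beta> i) (edge (PG M) \<beta> j)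
        (edge (PG M) (insert j \<beta>) i) (edge (PG M) (insert i \<beta>) j)"
      "structure_maps_hom (edge (PG M) \<beta> j) (edge (PG M) \<beta> i)
        (edge (PG M) (insert i \<beta>) j) (edge (PG M) (insert j \<beta>) i)"
    by (auto intro: structure_maps_hom_PG)
  with 4 show ?case
    unfolding double_groupoid_def by (auto intro!: groupoid_PG) (auto simp: PG_def insert_commute)
qed (auto intro!: groupoid_PG, auto simp: PG_def)

subsection \<open>Cube sums\<close>

context module
begin

lemma cube_sum_closed:
  assumes "finite \<gamma>" "v \<in> Pow \<gamma> \<rightarrow> carrier M" "t \<in> \<gamma> \<rightarrow> carrier R"
  shows "cube_sum R M t v \<gamma> \<in> carrier M"
  unfolding cube_sum_def
  by (rule M.finsum_closed) (use assms in \<open>auto intro!: smult_closed finprod_closed\<close>)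

lemma cube_sum_cong:
  assumes "v \<in> Pow \<gamma> \<rightarrow> carrier M" "t \<in> \<gamma> \<rightarrow> carrier R" "\<And>\<delta>. \<delta> \<subseteq> \<gamma> \<Longrightarrow> v' \<delta> = v \<delta>"
  shows "cube_sum R M t v' \<gamma> = cube_sum R M t v \<gamma>"
  unfolding cube_sum_def
  by (rule M.finsum_cong') (use assms in \<open>auto intro!: smult_closed finprod_closed\<close>)

lemma cube_sum_add:
  assumes "finite \<gamma>" "v \<in> Pow \<gamma> \<rightarrow> carrier M" "w \<in> Pow \<gamma> \<rightarrow> carrier M" "t \<in> \<gamma> \<rightarrow> carrier R"
  shows "cube_sum R M t (\<lambda>\<delta>. v \<delta> \<oplus>\<^bsub>M\<^esub> w \<delta>) \<gamma> = cube_sum R M t v \<gamma> \<oplus>\<^bsub>M\<^esub> cube_sum R M t w \<gamma>"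
proof -
  have P: "(\<Otimes>i\<in>\<delta>. t i) \<in> carrier R" if "\<delta> \<subseteq> \<gamma>" for \<delta>
    using that assms by (auto intro!: finprod_closed)
  have "cube_sum R M t (\<lambda>\<delta>. v \<delta> \<oplus>\<^bsub>M\<^esub> w \<delta>) \<gamma> =
      (\<Oplus>\<^bsub>M\<^esub>\<delta>\<in>Pow \<gamma>. (\<Otimes>i\<in>\<delta>. t i) \<odot>\<^bsub>M\<^esub> v \<delta> \<oplus>\<^bsub>M\<^esub> (\<Otimes>i\<in>\<delta>. t i) \<odot>\<^bsub>M\<^esub> w \<delta>)"
    unfolding cube_sum_def
    by (rule M.finsum_cong') (use assms P in \<open>auto simp: smult_r_distr Pi_iff\<close>)
  also have "\<dots> = cube_sum R M t v \<gamma> \<oplus>\<^bsub>M\<^esub> cube_sum R M t w \<gamma>"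
    unfolding cube_sum_def by (rule M.finsum_addf) (use assms P in \<open>auto simp: Pi_iff\<close>)
  finally show ?thesis .
qed

lemma cube_sum_zero: "t \<in> \<gamma> \<rightarrow> carrier R \<Longrightarrow> cube_sum R M t (\<lambda>\<delta>. \<zero>\<^bsub>M\<^esub>) \<gamma> = \<zero>\<^bsub>M\<^esub>"
  unfolding cube_sum_def
  by (rule M.add.finprod_one_eqI) (auto intro!: smult_r_null finprod_closed)

text \<open>\<open>Pow (insert i \<gamma>)\<close> is the disjoint union of
  \<open>Pow \<gamma>\<close> and its image under \<open>insert i\<close>, and on the image the
  coefficient contains the factor \<open>t i\<close>. Moving that factor into the family makes the
  second summand again a cube sum over \<gamma> with the same \<open>t\<close>, ready for
  induction.\<close>

lemma cube_sum_insert: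
  assumes fin: "finite \<gamma>" and i: "i \<notin> \<gamma>"
    and v: "v \<in> Pow (insert i \<gamma>) \<rightarrow> carrier M" and t: "t \<in> insert i \<gamma> \<rightarrow> carrier R"
  shows "cube_sum R M t v (insert i \<gamma>) =
    cube_sum R M t v \<gamma> \<oplus>\<^bsub>M\<^esub> cube_sum R M t (\<lambda>\<delta>. t i \<odot>\<^bsub>M\<^esub> v (insert i \<delta>)) \<gamma>"
proof -
  let ?f = "\<lambda>\<delta>. (\<Otimes>j\<in>\<delta>. t j) \<odot>\<^bsub>M\<^esub> v \<delta>"
  have P: "(\<Otimes>j\<in>\<delta>. t j) \<in> carrier R" if "\<delta> \<subseteq> insert i \<gamma>" for \<delta>
    using that t by (auto intro!: finprod_closed)
  have f: "?f \<delta> \<in> carrier M" if "\<delta> \<subseteq> insert i \<gamma>" for \<delta>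
    using that v P by (auto intro!: smult_closed)
  have v_i: "v (insert i \<delta>) \<in> carrier M" if "\<delta> \<subseteq> \<gamma>" for \<delta>
    using that v by auto
  have ti: "t i \<in> carrier R" using t by auto
  have inj: "inj_on (insert i) (Pow \<gamma>)"
    using i by (auto simp: inj_on_def)
  have "cube_sum R M t v (insert i \<gamma>) = (\<Oplus>\<^bsub>M\<^esub>\<delta>\<in>Pow \<gamma> \<union> insert i ` Pow \<gamma>. ?f \<delta>)"
    by (simp add: cube_sum_def Pow_insert)
  also have "\<dots> = (\<Oplus>\<^bsub>M\<^esub>\<delta>\<in>Pow \<gamma>. ?f \<delta>) \<oplus>\<^bsub>M\<^esub> (\<Oplus>\<^bsub>M\<^esub>\<delta>\<in>insert i ` Pow \<gamma>. ?f \<delta>)"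
    using fin i by (intro M.finsum_Un_disjoint) (auto intro!: f)
  also have "(\<Oplus>\<^bsub>M\<^esub>\<delta>\<in>insert i ` Pow \<gamma>. ?f \<delta>) = (\<Oplus>\<^bsub>M\<^esub>\<delta>\<in>Pow \<gamma>. ?f (insert i \<delta>))"
    by (rule M.finsum_reindex) (auto intro!: f inj)
  also have "\<dots> = (\<Oplus>\<^bsub>M\<^esub>\<delta>\<in>Pow \<gamma>. (\<Otimes>j\<in>\<delta>. t j) \<odot>\<^bsub>M\<^esub> (t i \<odot>\<^bsub>M\<^esub> v (insert i \<delta>)))"
  proof (rule M.finsum_cong')
    fix \<delta> assume \<delta>: "\<delta> \<in> Pow \<gamma>"
    then have "finite \<delta>" "i \<notin> \<delta>" "t \<in> \<delta> \<rightarrow> carrier R"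
      using fin i t by (auto dest: finite_subset)
    \<comment> \<open>The factor \<open>t i\<close> is commuted to the right so that associativity
      of the scalar action groups it with \<open>v (insert i \<delta>)\<close>.\<close>
    then have "(\<Otimes>j\<in>insert i \<delta>. t j) = (\<Otimes>j\<in>\<delta>. t j) \<otimes> t i"
      using ti P \<delta> by (simp add: m_comm)
    then show "?f (insert i \<delta>) = (\<Otimes>j\<in>\<delta>. t j) \<odot>\<^bsub>M\<^esub> (t i \<odot>\<^bsub>M\<^esub> v (insert i \<delta>))"
      using \<delta> v_i[of \<delta>] ti P[of \<delta>] by (simp add: smult_assoc1 subset_insertI2)
  qed (use ti v_i P in auto)
  finally show ?thesis by (simp add: cube_sum_def)
qed

section \<open>Inverting the cube sums over unit parameters\<close>

lemma smult_Units_cancel: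
  assumes "a \<in> Units R" "x \<in> carrier M" "y \<in> carrier M" "a \<odot>\<^bsub>M\<^esub> x = a \<odot>\<^bsub>M\<^esub> y"
  shows "x = y"
  by (metis assms Units_closed Units_inv_closed Units_l_inv smult_assoc1 smult_one)

text \<open>Induction on \<alpha> with both families arbitrary, because the hypothesis is used
  twice: for the entries whose index avoids \<open>i\<close>, and for the families
  \<open>?d v\<close> and \<open>?d w\<close>, which carry the remaining entries multiplied by the
  unit \<open>t i\<close>.\<close>

lemma cube_sum_inj:
  assumes "finite \<alpha>" "t \<in> \<alpha> \<rightarrow> Units R"
    and "v \<in> Pow \<alpha> \<rightarrow> carrier M" "w \<in> Pow \<alpha> \<rightarrow> carrier M"
    and "\<And>\<gamma>. \<gamma> \<subseteq> \<alpha> \<Longrightarrow> cube_sum R M t v \<gamma> = cube_sum R M t w \<gamma>"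
    and "\<gamma> \<subseteq> \<alpha>"
  shows "v \<gamma> = w \<gamma>"
  using assms
proof (induction \<alpha> arbitrary: v w \<gamma> rule: finite_induct)
  case empty
  from empty(4)[of "{}"] empty(2,3,5) show ?case
    by (auto simp: cube_sum_def)
next
  case (insert i \<alpha>)
  have t: "t \<in> insert i \<alpha> \<rightarrow> carrier R" and tU: "t i \<in> Units R" "t \<in> \<alpha> \<rightarrow> Units R"
    using insert.prems(1) by (auto simp: Pi_iff intro: Units_closed)
  have vw: "v \<in> Pow \<alpha> \<rightarrow> carrier M" "w \<in> Pow \<alpha> \<rightarrow> carrier M"
    using insert.prems(2,3) by auto
  let ?d = "\<lambda>v \<delta>. t i \<odot>\<^bsub>M\<^esub> v (insert i \<delta>)"
  have d: "?d v \<in> Pow \<alpha> \<rightarrow> carrier M" "?d w \<in> Pow \<alpha> \<rightarrow> carrier M"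
    using insert.prems(2,3) t by (auto intro!: smult_closed)
  have low: "v \<gamma> = w \<gamma>" if "\<gamma> \<subseteq> \<alpha>" for \<gamma>
    by (rule insert.IH[OF tU(2) vw _ that]) (auto intro!: insert.prems(4))
  have d_eq: "?d v \<delta> = ?d w \<delta>" if "\<delta> \<subseteq> \<alpha>" for \<delta>
  proof (rule insert.IH[OF tU(2) d _ that])
    fix \<gamma> assume \<gamma>: "\<gamma> \<subseteq> \<alpha>"
    have vw_in: "v \<delta> \<in> carrier M" "w \<delta> \<in> carrier M" if "\<delta> \<subseteq> insert i \<gamma>" for \<delta>
      using that \<gamma> by (auto intro!: funcset_mem[OF insert.prems(2)] funcset_mem[OF insert.prems(3)])
    have side: "finite \<gamma>" "i \<notin> \<gamma>" "t \<in> \<gamma> \<rightarrow> carrier R" "t \<in> insert i \<gamma> \<rightarrow> carrier R"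
        "v \<in> Pow \<gamma> \<rightarrow> carrier M" "w \<in> Pow \<gamma> \<rightarrow> carrier M"
        "v \<in> Pow (insert i \<gamma>) \<rightarrow> carrier M" "w \<in> Pow (insert i \<gamma>) \<rightarrow> carrier M"
        "?d v \<in> Pow \<gamma> \<rightarrow> carrier M" "?d w \<in> Pow \<gamma> \<rightarrow> carrier M"
      using \<gamma> insert.hyps t by (auto dest: finite_subset intro!: vw_in smult_closed)
    \<comment> \<open>By \<open>cube_sum_insert\<close> the cube sum of \<open>?d v\<close> is the
      difference of the cube sums of \<open>v\<close> at \<open>insert i \<gamma>\<close> and at
      \<gamma>, so it is determined by the given data.\<close>
    have "cube_sum R M t v (insert i \<gamma>) = cube_sum R M t w (insert i \<gamma>)"
        "cube_sum R M t v \<gamma> = cube_sum R M t w \<gamma>"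
      using \<gamma> by (auto intro!: insert.prems(4))
    then show "cube_sum R M t (?d v) \<gamma> = cube_sum R M t (?d w) \<gamma>"
      using side by (simp add: cube_sum_insert cube_sum_closed)
  qed
  have high: "v (insert i \<delta>) = w (insert i \<delta>)" if "\<delta> \<subseteq> \<alpha>" for \<delta>
    by (rule smult_Units_cancel[OF tU(1)]) (use that insert.prems(2,3) d_eq in auto)
  show ?case
  proof (cases "i \<in> \<gamma>")
    case True
    with high[of "\<gamma> - {i}"] insert.prems(5) show ?thesis
      by (auto simp: insert_absorb)
  next
    case False
    with low insert.prems(5) show ?thesis by blast
  qed
qed

text \<open>The induction hypothesis is applied to \<open>x\<close> on the subsets avoiding
  \<open>i\<close> and to the increments of \<open>x\<close> in direction \<open>i\<close>. The
  second solution, divided by \<open>t i\<close>, supplies the entries whose index contains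
  \<open>i\<close>.\<close>

lemma cube_sum_surj:
  assumes "finite \<alpha>" "t \<in> \<alpha> \<rightarrow> Units R" "x \<in> Pow \<alpha> \<rightarrow> carrier M"
  shows "\<exists>v \<in> Pow \<alpha> \<rightarrow>\<^sub>E carrier M. \<forall>\<gamma>. \<gamma> \<subseteq> \<alpha> \<longrightarrow> cube_sum R M t v \<gamma> = x \<gamma>"
  using assms
proof (induction \<alpha> arbitrary: x rule: finite_induct)
  case empty
  then show ?case
    by (intro bexI[of _ "\<lambda>\<gamma>\<in>{{}}. x {}"]) (auto simp: cube_sum_def)
next
  case (insert i \<alpha>)
  have t: "t \<in> insert i \<alpha> \<rightarrow> carrier R" and tU: "t i \<in> Units R" "t \<in> \<alpha> \<rightarrow> Units R"
    using insert.prems(1) by (auto simp: Pi_iff intro: Units_closed)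
  have "x \<in> Pow \<alpha> \<rightarrow> carrier M"
    using insert.prems(2) by auto
  from insert.IH[OF tU(2) this] obtain v
    where v: "v \<in> Pow \<alpha> \<rightarrow>\<^sub>E carrier M" "\<And>\<gamma>. \<gamma> \<subseteq> \<alpha> \<Longrightarrow> cube_sum R M t v \<gamma> = x \<gamma>"
    by blast
  have "(\<lambda>\<gamma>. x (insert i \<gamma>) \<ominus>\<^bsub>M\<^esub> x \<gamma>) \<in> Pow \<alpha> \<rightarrow> carrier M"
    using insert.prems(2) by (auto intro!: M.minus_closed)
  from insert.IH[OF tU(2) this] obtain w
    where w: "w \<in> Pow \<alpha> \<rightarrow>\<^sub>E carrier M"
      "\<And>\<gamma>. \<gamma> \<subseteq> \<alpha> \<Longrightarrow> cube_sum R M t w \<gamma> = x (insert i \<gamma>) \<ominus>\<^bsub>M\<^esub> x \<gamma>"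
    by blast
  \<comment> \<open>The factor \<open>inv (t i)\<close> cancels the \<open>t i\<close> that
    \<open>cube_sum_insert\<close> puts in front of the upper entries, so that they contribute
    exactly the cube sum of \<open>w\<close>.\<close>
  define u where "u = (\<lambda>\<gamma>\<in>Pow (insert i \<alpha>). if i \<in> \<gamma> then inv (t i) \<odot>\<^bsub>M\<^esub> w (\<gamma> - {i}) else v \<gamma>)"
  have vw: "v \<gamma> \<in> carrier M" "w \<gamma> \<in> carrier M" if "\<gamma> \<subseteq> \<alpha>" for \<gamma>
    using v(1) w(1) that by auto
  have u: "u \<in> Pow (insert i \<alpha>) \<rightarrow>\<^sub>E carrier M"
    using tU(1) vw by (auto simp: u_def subset_insert_iff intro!: smult_closed)
  have low: "cube_sum R M t u \<gamma> = x \<gamma>" if \<gamma>: "\<gamma> \<subseteq> \<alpha>" for \<gamma>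
  proof -
    have "cube_sum R M t u \<gamma> = cube_sum R M t v \<gamma>"
      using \<gamma> insert.hyps t vw by (intro cube_sum_cong) (auto simp: u_def)
    with v(2) \<gamma> show ?thesis by simp
  qed
  have high: "cube_sum R M t u (insert i \<gamma>) = x (insert i \<gamma>)" if \<gamma>: "\<gamma> \<subseteq> \<alpha>" for \<gamma>
  proof -
    have fin: "finite \<gamma>" "i \<notin> \<gamma>"
      using \<gamma> insert.hyps by (auto dest: finite_subset)
    have "t i \<odot>\<^bsub>M\<^esub> u (insert i \<delta>) = w \<delta>" if "\<delta> \<subseteq> \<gamma>" for \<delta>
    proof -
      have "insert i \<delta> - {i} = \<delta>" "insert i \<delta> \<subseteq> insert i \<alpha>" "\<delta> \<subseteq> \<alpha>"
        using that \<gamma> fin by auto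
      then show ?thesis
        using tU(1) vw by (simp add: u_def smult_assoc1[symmetric] Units_closed)
    qed
    then have "cube_sum R M t (\<lambda>\<delta>. t i \<odot>\<^bsub>M\<^esub> u (insert i \<delta>)) \<gamma> = cube_sum R M t w \<gamma>"
      using \<gamma> t vw by (intro cube_sum_cong) auto
    moreover have "u \<in> Pow (insert i \<gamma>) \<rightarrow> carrier M" "t \<in> insert i \<gamma> \<rightarrow> carrier R"
      using \<gamma> t by (auto intro!: PiE_mem[OF u])
    ultimately have "cube_sum R M t u (insert i \<gamma>) = x \<gamma> \<oplus>\<^bsub>M\<^esub> (x (insert i \<gamma>) \<ominus>\<^bsub>M\<^esub> x \<gamma>)"
      using \<gamma> by (simp add: cube_sum_insert[OF fin] low w(2))
    moreover have "x \<gamma> \<in> carrier M" "x (insert i \<gamma>) \<in> carrier M"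
      using insert.prems(2) \<gamma> by auto
    ultimately show ?thesis
      by (metis M.add.inv_closed M.a_lcomm M.minus_eq M.r_neg M.r_zero)
  qed
  have "cube_sum R M t u \<gamma> = x \<gamma>" if "\<gamma> \<subseteq> insert i \<alpha>" for \<gamma>
  proof (cases "i \<in> \<gamma>")
    case True
    with high[of "\<gamma> - {i}"] that show ?thesis
      by (auto simp: insert_absorb)
  next
    case False
    with low that show ?thesis by blast
  qed
  with u show ?case by blast
qed

section \<open>Cube sums of source, target, unit and product\<close>

lemma cube_sum_restrict:
  assumes "v \<in> Pow \<beta> \<rightarrow> carrier M" "t \<in> \<beta> \<rightarrow> carrier R" "\<gamma> \<subseteq> \<beta>"
  shows "cube_sum R M t (restrict v (Pow \<beta>)) \<gamma> = cube_sum R M t v \<gamma>"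
  by (rule cube_sum_cong) (use assms in auto)

text \<open>By additivity the left side splits into precisely the two summands of
  \<open>cube_sum_insert\<close>. In terms of cube sums the target is thus the target of the pair
  groupoid.\<close>

lemma cube_sum_target:
  assumes fin: "finite \<beta>" and i: "i \<notin> \<beta>" and v: "v \<in> Pow (insert i \<beta>) \<rightarrow> carrier M"
    and t: "t \<in> insert i \<beta> \<rightarrow> carrier R" and \<gamma>: "\<gamma> \<subseteq> \<beta>"
  shows "cube_sum R M t (\<lambda>\<gamma>\<in>Pow \<beta>. v \<gamma> \<oplus>\<^bsub>M\<^esub> t i \<odot>\<^bsub>M\<^esub> v (insert i \<gamma>)) \<gamma> =
    cube_sum R M t v (insert i \<gamma>)"
proof -
  have v_in: "v \<delta> \<in> carrier M" if "\<delta> \<subseteq> insert i \<beta>" for \<delta>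
    using that v by auto
  have side: "finite \<gamma>" "i \<notin> \<gamma>" "t \<in> \<gamma> \<rightarrow> carrier R" "t \<in> insert i \<gamma> \<rightarrow> carrier R" "t i \<in> carrier R"
      "v \<in> Pow \<gamma> \<rightarrow> carrier M" "v \<in> Pow (insert i \<gamma>) \<rightarrow> carrier M"
      "(\<lambda>\<delta>. t i \<odot>\<^bsub>M\<^esub> v (insert i \<delta>)) \<in> Pow \<gamma> \<rightarrow> carrier M"
    using \<gamma> fin i t by (auto dest: finite_subset intro!: v_in smult_closed)
  have "cube_sum R M t (\<lambda>\<gamma>\<in>Pow \<beta>. v \<gamma> \<oplus>\<^bsub>M\<^esub> t i \<odot>\<^bsub>M\<^esub> v (insert i \<gamma>)) \<gamma> =
      cube_sum R M t (\<lambda>\<gamma>. v \<gamma> \<oplus>\<^bsub>M\<^esub> t i \<odot>\<^bsub>M\<^esub> v (insert i \<gamma>)) \<gamma>"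
    by (rule cube_sum_cong) (use side \<gamma> in auto)
  also have "\<dots> = cube_sum R M t v (insert i \<gamma>)"
    using side by (simp add: cube_sum_add cube_sum_insert)
  finally show ?thesis .
qed

text \<open>The extension by zero vanishes at indices containing \<open>i\<close>, so the second
  summand in \<open>cube_sum_insert\<close> is zero and adding \<open>i\<close> to the index does
  not change the cube sum.\<close>

lemma cube_sum_unit:
  assumes fin: "finite \<beta>" and i: "i \<notin> \<beta>" and v: "v \<in> Pow \<beta> \<rightarrow> carrier M"
    and t: "t \<in> insert i \<beta> \<rightarrow> carrier R" and \<gamma>: "\<gamma> \<subseteq> insert i \<beta>"
  shows "cube_sum R M t (\<lambda>\<gamma>\<in>Pow (insert i \<beta>). if i \<in> \<gamma> then \<zero>\<^bsub>M\<^esub> else v \<gamma>) \<gamma> =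
    cube_sum R M t v (\<gamma> - {i})"
proof -
  let ?u = "\<lambda>\<gamma>\<in>Pow (insert i \<beta>). if i \<in> \<gamma> then \<zero>\<^bsub>M\<^esub> else v \<gamma>"
  have v_in: "v \<delta> \<in> carrier M" if "\<delta> \<subseteq> \<beta>" for \<delta>
    using that v by auto
  have low: "cube_sum R M t ?u \<delta> = cube_sum R M t v \<delta>" if "\<delta> \<subseteq> \<beta>" for \<delta>
    using that i t by (intro cube_sum_cong) (auto intro!: v_in)
  show ?thesis
  proof (cases "i \<in> \<gamma>")
    case True
    define \<delta> where "\<delta> = \<gamma> - {i}"
    have \<delta>: "\<delta> \<subseteq> \<beta>" "i \<notin> \<delta>" "finite \<delta>" "\<gamma> = insert i \<delta>"
      using True \<gamma> fin by (auto simp: \<delta>_def intro: finite_subset)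
    have t': "t \<in> \<delta> \<rightarrow> carrier R" "t \<in> insert i \<delta> \<rightarrow> carrier R" "t i \<in> carrier R"
      using t \<delta> by auto
    have *: "cube_sum R M t (\<lambda>\<epsilon>. t i \<odot>\<^bsub>M\<^esub> ?u (insert i \<epsilon>)) \<delta> = cube_sum R M t (\<lambda>\<epsilon>. \<zero>\<^bsub>M\<^esub>) \<delta>"
      using \<delta> t' by (intro cube_sum_cong) (auto simp: subset_insertI2 insert_mono)
    have u: "?u \<in> Pow (insert i \<delta>) \<rightarrow> carrier M"
    proof
      fix \<epsilon> assume "\<epsilon> \<in> Pow (insert i \<delta>)"
      then have "\<epsilon> \<subseteq> insert i \<beta>" "i \<notin> \<epsilon> \<Longrightarrow> \<epsilon> \<subseteq> \<beta>"
        using \<delta>(1) by auto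
      then show "?u \<epsilon> \<in> carrier M" by (auto intro: v_in)
    qed
    have "cube_sum R M t ?u \<gamma> = cube_sum R M t v \<delta> \<oplus>\<^bsub>M\<^esub> \<zero>\<^bsub>M\<^esub>"
      unfolding \<delta>(4) cube_sum_insert[OF \<delta>(3,2) u t'(2)] low[OF \<delta>(1)] *
        cube_sum_zero[OF t'(1)] ..
    moreover have "cube_sum R M t v \<delta> \<in> carrier M"
      using \<delta> t' by (intro cube_sum_closed) (auto intro!: v_in)
    ultimately show ?thesis by (simp add: \<delta>_def)
  next
    case False
    with \<gamma> low[of \<gamma>] show ?thesis by (simp add: subset_insert)
  qed
qed

text \<open>Here \<open>v\<close> is the arrow applied first and \<open>w\<close> the second, and
  \<open>eq\<close> says that they are composable. If \<open>i\<close> lies in \<gamma>, both sides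
  equal the sum of the cube sums of \<open>v\<close>, \<open>?d v\<close> and \<open>?d w\<close> at
  \<gamma> without \<open>i\<close>: on the left \<open>?d\<close> is additive, on the right the
  lower part of \<open>w\<close> is the target of \<open>v\<close>.\<close>

lemma cube_sum_comp:
  assumes fin: "finite \<beta>" and i: "i \<notin> \<beta>"
    and v: "v \<in> Pow (insert i \<beta>) \<rightarrow> carrier M" and w: "w \<in> Pow (insert i \<beta>) \<rightarrow> carrier M"
    and t: "t \<in> insert i \<beta> \<rightarrow> carrier R"
    and eq: "\<And>\<gamma>. \<gamma> \<subseteq> \<beta> \<Longrightarrow> w \<gamma> = v \<gamma> \<oplus>\<^bsub>M\<^esub> t i \<odot>\<^bsub>M\<^esub> v (insert i \<gamma>)"
    and \<gamma>: "\<gamma> \<subseteq> insert i \<beta>"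
  shows "cube_sum R M t (\<lambda>\<gamma>\<in>Pow (insert i \<beta>). if i \<in> \<gamma> then v \<gamma> \<oplus>\<^bsub>M\<^esub> w \<gamma> else v \<gamma>) \<gamma> =
    (if i \<in> \<gamma> then cube_sum R M t w \<gamma> else cube_sum R M t v \<gamma>)"
proof -
  let ?u = "\<lambda>\<gamma>\<in>Pow (insert i \<beta>). if i \<in> \<gamma> then v \<gamma> \<oplus>\<^bsub>M\<^esub> w \<gamma> else v \<gamma>"
  let ?d = "\<lambda>v \<epsilon>. t i \<odot>\<^bsub>M\<^esub> v (insert i \<epsilon>)"
  have in_M: "v \<delta> \<in> carrier M" "w \<delta> \<in> carrier M" if "\<delta> \<subseteq> insert i \<beta>" for \<delta>
    using that v w by auto
  have low: "cube_sum R M t ?u \<delta> = cube_sum R M t v \<delta>" if "\<delta> \<subseteq> \<beta>" for \<delta>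
    using that i t by (intro cube_sum_cong) (auto intro!: in_M)
  show ?thesis
  proof (cases "i \<in> \<gamma>")
    case True
    define \<delta> where "\<delta> = \<gamma> - {i}"
    have \<delta>: "\<delta> \<subseteq> \<beta>" "i \<notin> \<delta>" "finite \<delta>" "\<gamma> = insert i \<delta>"
      using True \<gamma> fin by (auto simp: \<delta>_def intro: finite_subset)
    have t': "t \<in> \<delta> \<rightarrow> carrier R" "t \<in> insert i \<delta> \<rightarrow> carrier R" "t i \<in> carrier R"
      using t \<delta> by auto
    have u: "?u \<in> Pow (insert i \<delta>) \<rightarrow> carrier M"
    proof
      fix \<epsilon> assume "\<epsilon> \<in> Pow (insert i \<delta>)"
      then have "\<epsilon> \<subseteq> insert i \<beta>"
        using \<delta>(1) by auto
      then show "?u \<epsilon> \<in> carrier M" by (simp add: in_M)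
    qed
    have side: "v \<in> Pow \<delta> \<rightarrow> carrier M" "w \<in> Pow (insert i \<delta>) \<rightarrow> carrier M"
        "?d v \<in> Pow \<delta> \<rightarrow> carrier M" "?d w \<in> Pow \<delta> \<rightarrow> carrier M"
      using \<delta>(1) t' by (auto intro!: in_M smult_closed)
    have "?d ?u \<epsilon> = ?d v \<epsilon> \<oplus>\<^bsub>M\<^esub> ?d w \<epsilon>" if "\<epsilon> \<subseteq> \<delta>" for \<epsilon>
      using that \<delta> t' in_M[of "insert i \<epsilon>"] by (auto simp: smult_r_distr)
    then have "cube_sum R M t (?d ?u) \<delta> = cube_sum R M t (\<lambda>\<epsilon>. ?d v \<epsilon> \<oplus>\<^bsub>M\<^esub> ?d w \<epsilon>) \<delta>"
      using side t' by (intro cube_sum_cong) (auto intro!: M.add.m_closed)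
    also have "\<dots> = cube_sum R M t (?d v) \<delta> \<oplus>\<^bsub>M\<^esub> cube_sum R M t (?d w) \<delta>"
      using side \<delta> t' by (intro cube_sum_add)
    finally have "cube_sum R M t ?u \<gamma> =
        cube_sum R M t v \<delta> \<oplus>\<^bsub>M\<^esub> (cube_sum R M t (?d v) \<delta> \<oplus>\<^bsub>M\<^esub> cube_sum R M t (?d w) \<delta>)"
      unfolding \<delta>(4) cube_sum_insert[OF \<delta>(3,2) u t'(2)] low[OF \<delta>(1)] by simp
    moreover have "cube_sum R M t w \<gamma> =
        cube_sum R M t v \<delta> \<oplus>\<^bsub>M\<^esub> cube_sum R M t (?d v) \<delta> \<oplus>\<^bsub>M\<^esub> cube_sum R M t (?d w) \<delta>"
    proof -
      \<comment> \<open>Composability is used here to express the lower entries of \<open>w\<close>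
        through \<open>v\<close>.\<close>
      have "cube_sum R M t w \<delta> = cube_sum R M t (\<lambda>\<epsilon>. v \<epsilon> \<oplus>\<^bsub>M\<^esub> ?d v \<epsilon>) \<delta>"
        using \<delta> side t' by (intro cube_sum_cong) (auto simp: eq intro!: M.add.m_closed)
      also have "\<dots> = cube_sum R M t v \<delta> \<oplus>\<^bsub>M\<^esub> cube_sum R M t (?d v) \<delta>"
        using side \<delta> t' by (intro cube_sum_add)
      finally show ?thesis
        unfolding \<delta>(4) cube_sum_insert[OF \<delta>(3,2) side(2) t'(2)] by simp
    qed
    moreover have "cube_sum R M t v \<delta> \<in> carrier M" "cube_sum R M t (?d v) \<delta> \<in> carrier M"
        "cube_sum R M t (?d w) \<delta> \<in> carrier M"
      using \<delta> t' side by (auto intro!: cube_sum_closed)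
    ultimately show ?thesis
      using True by (simp add: M.a_assoc)
  next
    case False
    with \<gamma> low[of \<gamma>] show ?thesis by (simp add: subset_insert)
  qed
qed

section \<open>The finite part and its map to the product groupoid\<close>

lemma vert_Gsyfi:
  "(v, t) \<in> vert (Gsyfi R M n U) \<alpha> \<longleftrightarrow> t \<in> {1..n} \<rightarrow>\<^sub>E Units R \<and> v \<in> Pow \<alpha> \<rightarrow>\<^sub>E carrier M \<and>
    (\<forall>\<gamma>. \<gamma> \<subseteq> \<alpha> \<longrightarrow> cube_sum R M t v \<gamma> \<in> U)"
  by (auto simp: Gsyfi_def nfold_part_def Gsy_def Gsy_vert_def Gsy_fibre_def PiE_iff
      intro: Units_closed)

lemma edge_Gsyfi:
  "edge (Gsyfi R M n U) \<beta> i = (edge (Gsy R M n U) \<beta> i)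
    \<lparr>gobj := vert (Gsyfi R M n U) \<beta>, gmor := vert (Gsyfi R M n U) (insert i \<beta>)\<rparr>"
  by (simp add: Gsyfi_def nfold_part_def Gsy_def)

text \<open>Both claims rest on the same four identities. Each cube sum of a source, target, unit or
  product is a cube sum of one of the arguments, possibly at another index. Hence it stays in the
  mere subset \<open>U\<close>, and it is the entry that the pair groupoid prescribes.\<close>

lemma
  assumes \<beta>: "\<beta> \<subseteq> {1..n}" and i: "i \<in> {1..n} - \<beta>"
  shows groupoid_closed_Gsyfi: "groupoid_closed (edge (Gsyfi R M n U) \<beta> i)" (is ?closed)
    and groupoid_hom_Gsyfi: "groupoid_hom (edge (Gsyfi R M n U) \<beta> i)
      (edge (nfold_prod (PG U) (nfold_trivial ({1..n} \<rightarrow>\<^sub>E Units R))) \<beta> i)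
      (\<lambda>(v, t). (restrict (cube_sum R M t v) (Pow \<beta>), t))
      (\<lambda>(v, t). (restrict (cube_sum R M t v) (Pow (insert i \<beta>)), t))" (is ?hom)
proof -
  have fin: "finite \<beta>" "i \<notin> \<beta>"
    using \<beta> i by (auto intro: finite_subset)
  have t: "t \<in> insert i \<beta> \<rightarrow> carrier R" "t \<in> \<beta> \<rightarrow> carrier R" "t i \<in> carrier R"
    if "t \<in> {1..n} \<rightarrow>\<^sub>E Units R" for t
    using that \<beta> i by (auto intro!: Units_closed)
  have sub: "\<gamma> - {i} \<subseteq> \<beta>" "i \<notin> \<gamma> \<Longrightarrow> \<gamma> \<subseteq> \<beta>" if "\<gamma> \<subseteq> insert i \<beta>" for \<gamma>
    using that by auto
  have v_in: "v \<gamma> \<in> carrier M" if "v \<in> Pow \<alpha> \<rightarrow>\<^sub>E carrier M" "\<gamma> \<subseteq> \<alpha>" for v \<alpha> \<gamma>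
    using that by auto
  have src: "cube_sum R M t (restrict v (Pow \<beta>)) \<gamma> = cube_sum R M t v \<gamma>"
    if "t \<in> {1..n} \<rightarrow>\<^sub>E Units R" "v \<in> Pow (insert i \<beta>) \<rightarrow>\<^sub>E carrier M" "\<gamma> \<subseteq> \<beta>" for t v \<gamma>
    using that by (intro cube_sum_restrict t) (auto intro!: v_in[OF that(2)])
  have tgt: "cube_sum R M t (\<lambda>\<gamma>\<in>Pow \<beta>. v \<gamma> \<oplus>\<^bsub>M\<^esub> t i \<odot>\<^bsub>M\<^esub> v (insert i \<gamma>)) \<gamma> = cube_sum R M t v (insert i \<gamma>)"
    if "t \<in> {1..n} \<rightarrow>\<^sub>E Units R" "v \<in> Pow (insert i \<beta>) \<rightarrow>\<^sub>E carrier M" "\<gamma> \<subseteq> \<beta>" for t v \<gamma>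
    using that by (intro cube_sum_target fin t) (auto intro!: v_in[OF that(2)])
  have unit: "cube_sum R M t (\<lambda>\<gamma>\<in>Pow (insert i \<beta>). if i \<in> \<gamma> then \<zero>\<^bsub>M\<^esub> else v \<gamma>) \<gamma> =
      cube_sum R M t v (\<gamma> - {i})"
    if "t \<in> {1..n} \<rightarrow>\<^sub>E Units R" "v \<in> Pow \<beta> \<rightarrow>\<^sub>E carrier M" "\<gamma> \<subseteq> insert i \<beta>" for t v \<gamma>
    using that by (intro cube_sum_unit fin t) (auto intro!: v_in[OF that(2)])
  have comp: "cube_sum R M t (\<lambda>\<gamma>\<in>Pow (insert i \<beta>). if i \<in> \<gamma> then v \<gamma> \<oplus>\<^bsub>M\<^esub> w \<gamma> else v \<gamma>) \<gamma> =
      (if i \<in> \<gamma> then cube_sum R M t w \<gamma> else cube_sum R M t v \<gamma>)"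
    if "t \<in> {1..n} \<rightarrow>\<^sub>E Units R" "v \<in> Pow (insert i \<beta>) \<rightarrow>\<^sub>E carrier M"
      "w \<in> Pow (insert i \<beta>) \<rightarrow>\<^sub>E carrier M"
      "(\<lambda>\<gamma>\<in>Pow \<beta>. v \<gamma> \<oplus>\<^bsub>M\<^esub> t i \<odot>\<^bsub>M\<^esub> v (insert i \<gamma>)) = restrict w (Pow \<beta>)"
      "\<gamma> \<subseteq> insert i \<beta>" for t v w \<gamma>
  proof (rule cube_sum_comp[OF fin _ _ t(1)])
    show "w \<delta> = v \<delta> \<oplus>\<^bsub>M\<^esub> t i \<odot>\<^bsub>M\<^esub> v (insert i \<delta>)" if "\<delta> \<subseteq> \<beta>" for \<delta>
      using fun_cong[OF \<open>_ = restrict w (Pow \<beta>)\<close>, of \<delta>] that by simp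
  qed (use that in \<open>auto intro!: v_in[OF that(2)] v_in[OF that(3)]\<close>)
  show ?closed
    unfolding groupoid_closed_def edge_Gsyfi
  proof ((intro conjI funcsetI ballI impI; clarsimp simp: Gsy_def vert_Gsyfi simp del: One_nat_def),
      goal_cases)
    \<comment> \<open>The cases are source, target, unit and product, in this order.\<close>
    case 1
    then show ?case by (auto simp: src intro!: v_in[of _ "insert i \<beta>"])
  next
    case 2
    then show ?case
      by (auto simp: tgt subset_insertI2 t intro!: v_in[of _ "insert i \<beta>"] M.add.m_closed smult_closed)
  next
    case 3
    then show ?case
      by (intro conjI funcsetI allI impI) (simp_all add: unit sub v_in[of _ \<beta>])
  next
    case 4
    then show ?case
      by (intro conjI funcsetI allI impI) (simp_all add: comp v_in[of _ "insert i \<beta>"])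
  qed
  \<comment> \<open>In the second component composability forces equal parameters, which matches the
    trivial factor; the first components are compared index by index.\<close>
  show ?hom
    unfolding groupoid_hom_def edge_Gsyfi
    by (intro conjI funcsetI ballI impI; clarsimp simp: Gsy_def vert_Gsyfi nfold_prod_def PG_def
        nfold_trivial_def prod_groupoid_def simp del: One_nat_def)
      (rule ext, simp add: src tgt unit comp sub subset_insertI2)+
qed

text \<open>The parameter \<open>t\<close> is preserved, so the question is one on each fibre,
  settled by \<open>cube_sum_inj\<close> and \<open>cube_sum_surj\<close>. The inclusion of
  \<open>U\<close> in the carrier lets a family in \<open>U\<close> be treated as prescribed cube
  sums in the module.\<close>

lemma bij_betw_Gsyfi:
  assumes U: "U \<subseteq> carrier M" and \<alpha>: "\<alpha> \<subseteq> {1..n}"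
  shows "bij_betw (\<lambda>(v, t). (restrict (cube_sum R M t v) (Pow \<alpha>), t)) (vert (Gsyfi R M n U) \<alpha>)
    (vert (nfold_prod (PG U) (nfold_trivial ({1..n} \<rightarrow>\<^sub>E Units R))) \<alpha>)"
    (is "bij_betw ?f ?C ?D")
proof (rule bij_betw_imageI)
  have fin: "finite \<alpha>"
    using \<alpha> by (auto intro: finite_subset)
  have t: "t \<in> \<alpha> \<rightarrow> Units R" if "t \<in> {1..n} \<rightarrow>\<^sub>E Units R" for t
    using that \<alpha> by auto
  have D: "?D = (Pow \<alpha> \<rightarrow>\<^sub>E U) \<times> ({1..n} \<rightarrow>\<^sub>E Units R)"
    by (simp add: nfold_prod_def PG_def nfold_trivial_def)
  show "inj_on ?f ?C"
  proof (rule inj_onI)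
    fix p q assume p: "p \<in> ?C" and q: "q \<in> ?C" and eq: "?f p = ?f q"
    then obtain v w t where pq: "p = (v, t)" "q = (w, t)"
      by (auto split: prod.splits)
    have vw: "t \<in> {1..n} \<rightarrow>\<^sub>E Units R" "v \<in> Pow \<alpha> \<rightarrow>\<^sub>E carrier M" "w \<in> Pow \<alpha> \<rightarrow>\<^sub>E carrier M"
      using p q unfolding pq vert_Gsyfi by blast+
    have "restrict (cube_sum R M t v) (Pow \<alpha>) = restrict (cube_sum R M t w) (Pow \<alpha>)"
      using eq unfolding pq by simp
    then have sums: "cube_sum R M t v \<gamma> = cube_sum R M t w \<gamma>" if "\<gamma> \<subseteq> \<alpha>" for \<gamma>
      using that by (metis PowI restrict_apply')
    have "v = w"
    \<comment> \<open>Outside \<open>Pow \<alpha>\<close> both families are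
      \<open>undefined\<close>, so agreement of the entries gives equality of functions.\<close>
    proof (rule PiE_ext[OF vw(2,3)])
      fix \<gamma> assume "\<gamma> \<in> Pow \<alpha>"
      then show "v \<gamma> = w \<gamma>"
        using vw(2,3) by - (rule cube_sum_inj[OF fin t[OF vw(1)] _ _ sums], simp_all add: PiE_def)
    qed
    then show "p = q" by (simp add: pq)
  qed
  show "?f ` ?C = ?D"
  proof (intro equalityI subsetI)
    fix q assume "q \<in> ?f ` ?C"
    then obtain v t where "q = ?f (v, t)" "(v, t) \<in> ?C"
      by auto
    then show "q \<in> ?D"
      unfolding D vert_Gsyfi by (simp add: restrict_PiE_iff)
  next
    fix q assume "q \<in> ?D"
    then obtain x t where q: "q = (x, t)" "x \<in> Pow \<alpha> \<rightarrow>\<^sub>E U" "t \<in> {1..n} \<rightarrow>\<^sub>E Units R"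
      unfolding D by auto
    have "x \<in> Pow \<alpha> \<rightarrow> carrier M"
      using q(2) U by auto
    from cube_sum_surj[OF fin t[OF q(3)] this] obtain v where v: "v \<in> Pow \<alpha> \<rightarrow>\<^sub>E carrier M"
        "\<And>\<gamma>. \<gamma> \<subseteq> \<alpha> \<Longrightarrow> cube_sum R M t v \<gamma> = x \<gamma>"
      by blast
    \<comment> \<open>Membership in the fibre is automatic: the cube sums of \<open>v\<close> are
      the entries of \<open>x\<close>, which lie in \<open>U\<close>.\<close>
    have vt: "(v, t) \<in> ?C"
      unfolding vert_Gsyfi using v(1) q(3) PiE_mem[OF q(2)] by (simp add: v(2))
    have "restrict (cube_sum R M t v) (Pow \<alpha>) = x"
      using restrict_ext[of "Pow \<alpha>" "cube_sum R M t v" x] v(2) PiE_restrict[OF q(2)] by simp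
    then have "q = ?f (v, t)"
      by (simp add: q(1))
    then show "q \<in> ?f ` ?C"
      using vt by (rule image_eqI)
  qed
qed

end

theorem theorem4p5:
  fixes K :: "('k, 'm) ring_scheme"
    and V :: "('k, 'v, 'w) module_scheme"
    and U :: "'v set"
    and n :: nat
  assumes "module K V"
    and "U \<subseteq> carrier V"
  shows "nfold_groupoid n (Gsyfi K V n U)
    \<and> nfold_groupoid n (nfold_prod (PG U) (nfold_trivial ({1..n} \<rightarrow>\<^sub>E Units K)))
    \<and> nfold_iso n (Gsyfi K V n U)
        (nfold_prod (PG U) (nfold_trivial ({1..n} \<rightarrow>\<^sub>E Units K)))
        (\<lambda>\<alpha> (v, t).
          (\<lambda>\<gamma>\<in>Pow \<alpha>. \<Oplus>\<^bsub>V\<^esub>\<delta>\<in>Pow \<gamma>. (\<Otimes>\<^bsub>K\<^esub>i\<in>\<delta>. t i) \<odot>\<^bsub>V\<^esub> v \<delta>, t))"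
proof -
  interpret module K V by (rule assms(1))
  let ?C = "Gsyfi K V n U"
  let ?D = "nfold_prod (PG U) (nfold_trivial ({1..n} \<rightarrow>\<^sub>E Units K))"
  let ?f = "\<lambda>\<alpha> (v, t). (restrict (cube_sum K V t v) (Pow \<alpha>), t)"
  have D: "nfold_groupoid n ?D"
    by (intro nfold_groupoid_prod nfold_groupoid_PG nfold_groupoid_trivial)
  have bij: "bij_betw (?f \<alpha>) (vert ?C \<alpha>) (vert ?D \<alpha>)" if "\<alpha> \<subseteq> {1..n}" for \<alpha>
    using bij_betw_Gsyfi[OF assms(2) that] .
  have f: "nfold_hom n ?C ?D ?f"
    unfolding nfold_hom_def
  proof (intro conjI allI impI)
    show "?f \<alpha> \<in> vert ?C \<alpha> \<rightarrow> vert ?D \<alpha>" if "\<alpha> \<subseteq> {1..n}" for \<alpha>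
      by (rule bij_betw_imp_funcset[OF bij[OF that]])
    show "groupoid_hom (edge ?C \<beta> i) (edge ?D \<beta> i) (?f \<beta>) (?f (insert i \<beta>))"
      if "\<beta> \<subseteq> {1..n} \<and> i \<in> {1..n} - \<beta>" for \<beta> i
      by (rule groupoid_hom_Gsyfi; use that in blast)
  qed
  have C: "nfold_groupoid n ?C"
  proof (rule nfold_groupoid_transport[OF D f bij])
    show "groupoid_closed (edge ?C \<beta> i)" if "\<beta> \<subseteq> {1..n}" "i \<in> {1..n} - \<beta>" for \<beta> i
      using that by (rule groupoid_closed_Gsyfi)
  qed (simp_all add: edge_Gsyfi)
  \<comment> \<open>The map written out in the statement is the restricted \<open>cube_sum\<close>
    handled by the lemmas.\<close>
  have f_eq: "(\<lambda>\<alpha> (v, t). (\<lambda>\<gamma>\<in>Pow \<alpha>. \<Oplus>\<^bsub>V\<^esub>\<delta>\<in>Pow \<gamma>. (\<Otimes>\<^bsub>K\<^esub>i\<in>\<delta>. t i) \<odot>\<^bsub>V\<^esub> v \<delta>, t)) = ?f"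
    by (simp add: cube_sum_def[abs_def])
  show ?thesis
    unfolding f_eq by (intro conjI C D nfold_iso_if_bij[OF C D f bij])
qed

end
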